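(* Let $T$ be a tree with $\sigma(T)=\tau_{\mathrm{ind}}(T)$. For every $\delta>0$ there exist $\varepsilon>0$ and $n_0$ such that for all $n\ge n_0$ the following holds: if $\mathcal{H}$ is an $n$-vertex $3$-graph containing no copy of $T^3$ with $$|\mathcal{H}|\ge\left(\frac{\sigma(T)-1}{2}-\varepsilon\right)n^2,$$ then $\mathcal{H}$ is $\delta$-close to $\mathcal{S}(n,\sigma(T)-1)$.
   Context: For a graph $F$, $|F|$ is its number of edges and $F-I$ the subgraph induced on $V(F)\setminus I$. The crosscut number is $\sigma(F)=\min\{|I|+|F-I| : I \text{ independent in } F\}$. For bipartite $F$, $\tau_{\mathrm{ind}}(F)$ is the minimum size of $S\subseteq V(F)$ with $|S\cap e|=1$ for every edge $e$. The expansion $T^3$ of a graph $T$ is the $3$-graph obtained by adding to each edge a new vertex, distinct edges receiving distinct new vertices. For a $3$-graph $\mathcal{H}$ and $L\subseteq V(\mathcal{H})$, $\mathcal{H}-L$ is the set of edges of $\mathcal{H}$ disjoint from $L$, and $d_{\mathcal{H}}(v)$ is the number of edges containing $v$. For $n\ge t\ge 0$, $\mathcal{S}(n,t)=\{e\in\binom{[n]}{3}: |e\cap[t]|\ge1\}$. An $n$-vertex $3$-graph $\mathcal{H}$ is $\delta$-close to $\mathcal{S}(n,t)$ if there exists $L\subseteq V(\mathcal{H})$ with $|L|=t$ such that $|\mathcal{H}-L|\le\delta n^2$ and $d_{\mathcal{H}}(v)\ge(1/2-\delta)n^2$ for all $v\in L$. *)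

theory Defs
  imports Complex_Main
begin

definition graph :: "'a set \<Rightarrow> 'a set set \<Rightarrow> bool" where
  "graph V E \<longleftrightarrow> finite V \<and> (\<forall>e\<in>E. e \<subseteq> V \<and> card e = 2)"

definition connected_graph :: "'a set \<Rightarrow> 'a set set \<Rightarrow> bool" where
  "connected_graph V E \<longleftrightarrow>
     (\<forall>x\<in>V. \<forall>y\<in>V. (\<lambda>u v. {u, v} \<in> E)\<^sup>*\<^sup>* x y)"

definition is_tree :: "'a set \<Rightarrow> 'a set set \<Rightarrow> bool" where
  "is_tree V E \<longleftrightarrow> graph V E \<and> V \<noteq> {} \<and> connected_graph V E \<and> card E = card V - 1"

definition independent :: "'a set \<Rightarrow> 'a set set \<Rightarrow> 'a set \<Rightarrow> bool" where
  "independent V E I \<longleftrightarrow> I \<subseteq> V \<and> (\<forall>e\<in>E. \<not> e \<subseteq> I)"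

text \<open>Crosscut number: min over independent I of |I| + |F - I|, where F - I is the
  subgraph induced on V - I, whose edges are those disjoint from I.\<close>
definition crosscut :: "'a set \<Rightarrow> 'a set set \<Rightarrow> nat" where
  "crosscut V E = Min ((\<lambda>I. card I + card {e\<in>E. e \<inter> I = {}}) ` {I. independent V E I})"

definition tau_ind :: "'a set \<Rightarrow> 'a set set \<Rightarrow> nat" where
  "tau_ind V E = Min (card ` {S. S \<subseteq> V \<and> (\<forall>e\<in>E. card (S \<inter> e) = 1)})"

definition three_graph :: "nat \<Rightarrow> nat set set \<Rightarrow> bool" where
  "three_graph n H \<longleftrightarrow> (\<forall>e\<in>H. e \<subseteq> {..<n} \<and> card e = 3)"

text \<open>H contains a copy of the expansion T^3 of the graph (V,E): vertices of T map
  injectively via phi, the new expansion vertex of edge e maps to psi e, all images distinct.\<close>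
definition contains_expansion :: "nat set set \<Rightarrow> 'a set \<Rightarrow> 'a set set \<Rightarrow> bool" where
  "contains_expansion H V E \<longleftrightarrow>
     (\<exists>(phi :: 'a \<Rightarrow> nat) (psi :: 'a set \<Rightarrow> nat).
        inj_on phi V \<and> inj_on psi E \<and> phi ` V \<inter> psi ` E = {} \<and>
        (\<forall>e\<in>E. insert (psi e) (phi ` e) \<in> H))"

definition degree3 :: "nat set set \<Rightarrow> nat \<Rightarrow> nat" where
  "degree3 H v = card {e\<in>H. v \<in> e}"

definition delete3 :: "nat set set \<Rightarrow> nat set \<Rightarrow> nat set set" where
  "delete3 H L = {e\<in>H. e \<inter> L = {}}"

definition delta_close :: "real \<Rightarrow> nat \<Rightarrow> nat set set \<Rightarrow> nat \<Rightarrow> bool" where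
  "delta_close \<delta> n H t \<longleftrightarrow>
     (\<exists>L. L \<subseteq> {..<n} \<and> card L = t \<and>
          real (card (delete3 H L)) \<le> \<delta> * real n ^ 2 \<and>
          (\<forall>v\<in>L. real (degree3 H v) \<ge> (1/2 - \<delta>) * real n ^ 2))"

end

theory Submission
  imports Defs
begin

text \<open>The hypothesis makes \<open>\<sigma>\<close> the size of a side \<open>A\<close> of the bipartition of \<open>T\<close>.
  Call a pair fat if its codegree is at least \<open>2 |V|\<close>. Fat pairs form a graph without copy of \<open>T\<close>, so
  there are \<open>O(n)\<close> of them, boundedly many vertices (hubs) have linear fat degree, and few vertices
  have fat degree above a large constant. Up to \<open>o(n\<^sup>2)\<close> edges, every edge consists of a hub \<open>w\<close> and a
  light pair \<open>xy\<close> with \<open>wx\<close> and \<open>wy\<close> fat, or has exactly one fat pair and all its vertices have bounded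
  fat degree.

  Charge an edge of the first kind to \<open>xy\<close>, and one of the second kind half to each of its two light
  pairs. If more than \<open>O(n)\<close> light pairs lay in at least \<open>\<sigma>\<close> of these edges, \<open>T\<close> could be embedded greedily
  into those pairs, with some vertices of \<open>A\<close> moved to hubs, and the fat neighbours of the endpoints
  would serve as expansion vertices. Hence almost every pair receives charge at most \<open>\<sigma> - 1\<close>, with
  equality only if all of its edges come from hubs. If \<open>|H|\<close> is nearly maximal, almost every pair thus
  has \<open>\<sigma> - 1\<close> common fat hub neighbours; as almost no vertex has \<open>\<sigma>\<close> of them, almost all vertices have
  the same set \<open>L\<close> of fat hub neighbours.\<close>

section \<open>Growing and embedding trees\<close>

text \<open>Trees built by attaching one leaf at a time. Rule induction along this order drives the
  greedy embeddings.\<close>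

inductive grown :: "'a set \<Rightarrow> 'a set set \<Rightarrow> bool" where
  single: "grown {r} {}"
| leaf: "grown V E \<Longrightarrow> u \<in> V \<Longrightarrow> v \<notin> V \<Longrightarrow> grown (insert v V) (insert {u, v} E)"

lemma grown_basic:
  assumes "grown V E"
  shows "finite V \<and> finite E \<and> (\<forall>e\<in>E. e \<subseteq> V) \<and> card V = Suc (card E)"
  using assms
proof induction
  case (leaf V E u v)
  then have "{u, v} \<notin> E" by auto
  with leaf show ?case by auto
qed auto

lemma crossing_edge:
  assumes "(\<lambda>u v. {u, v} \<in> E)\<^sup>*\<^sup>* x y" and "x \<in> X" and "y \<notin> X"
  shows "\<exists>u\<in>X. \<exists>v. v \<notin> X \<and> {u, v} \<in> E"
  using assms by (induction rule: rtranclp_induct) auto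

text \<open>A subtree grows inside the tree: while a vertex is missing, connectivity gives an edge
  leaving the vertices reached so far. At \<open>card V\<close> vertices it has
  \<open>card V - 1\<close> edges, hence all of \<open>E\<close>.\<close>

lemma tree_grown:
  assumes "is_tree V E"
  shows "grown V E"
proof -
  have fin: "finite V" and sub: "\<And>e. e \<in> E \<Longrightarrow> e \<subseteq> V" and ne: "V \<noteq> {}"
    and con: "connected_graph V E" and cE: "card E = card V - 1"
    using assms by (auto simp: is_tree_def graph_def)
  have "finite E"
    using fin sub by (intro finite_subset[of E "Pow V"]) auto
  have "\<exists>V0 E0. grown V0 E0 \<and> V0 \<subseteq> V \<and> E0 \<subseteq> E \<and> card V0 = Suc k" if "Suc k \<le> card V" for k
    using that
  proof (induction k)
    case 0
    obtain r where "r \<in> V" using ne by auto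
    then have "grown {r} {} \<and> {r} \<subseteq> V \<and> {} \<subseteq> E \<and> card {r} = Suc 0"
      by (auto intro: grown.single)
    then show ?case by blast
  next
    case (Suc k)
    then obtain V0 E0 where g: "grown V0 E0" "V0 \<subseteq> V" "E0 \<subseteq> E" "card V0 = Suc k" by auto
    obtain x where x: "x \<in> V0" using g(4) by fastforce
    have "V0 \<noteq> V" using g(4) Suc.prems by auto
    then obtain y where y: "y \<in> V" "y \<notin> V0" using g(2) by auto
    have "(\<lambda>u v. {u, v} \<in> E)\<^sup>*\<^sup>* x y"
      using con x y g(2) by (auto simp: connected_graph_def)
    then obtain u v where uv: "u \<in> V0" "v \<notin> V0" "{u, v} \<in> E"
      using crossing_edge x y(2) by metis
    have "grown (insert v V0) (insert {u, v} E0)" using grown.leaf[OF g(1) uv(1,2)] .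
    moreover have "card (insert v V0) = Suc (Suc k)"
      using g grown_basic uv by (metis card_insert_disjoint)
    moreover have "insert v V0 \<subseteq> V" using g(2) sub[OF uv(3)] by auto
    ultimately show ?case using g(3) uv(3) by (metis insert_subset)
  qed
  moreover have "Suc (card V - 1) = card V"
    using fin ne by (simp add: card_gt_0_iff)
  ultimately obtain V0 E0 where g: "grown V0 E0" "V0 \<subseteq> V" "E0 \<subseteq> E" "card V0 = card V"
    by (metis le_refl)
  have "V0 = V" using g fin by (simp add: card_subset_eq)
  have "card E0 = card E" using grown_basic[OF g(1)] g(4) cE by auto
  then have "E0 = E" using g(3) \<open>finite E\<close> by (simp add: card_subset_eq)
  with g(1) \<open>V0 = V\<close> show ?thesis by simp
qed

text \<open>A colour class is extended leaf by leaf: the new leaf joins \<open>S\<close> exactly if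
  its neighbour is not in \<open>S\<close>. This makes the minimum in \<open>tau_ind\<close> range
  over a nonempty family.\<close>

lemma grown_bipartite:
  assumes "grown V E"
  shows "\<exists>S\<subseteq>V. \<forall>e\<in>E. card (S \<inter> e) = 1"
  using assms
proof induction
  case (leaf V E u v)
  then obtain S where S: "S \<subseteq> V" "\<forall>e\<in>E. card (S \<inter> e) = 1" by auto
  have sub: "\<forall>e\<in>E. v \<notin> e" using grown_basic[OF leaf(1)] leaf(3) by auto
  show ?case
  proof (cases "u \<in> S")
    case True
    then have "S \<inter> {u, v} = {u}" using S leaf by auto
    then show ?thesis using S by (intro exI[of _ S]) auto
  next
    case False
    then have "card (insert v S \<inter> {u, v}) = card {v}" by (intro arg_cong[of _ _ card]) auto
    moreover have "insert v S \<inter> e = S \<inter> e" if "e \<in> E" for e using sub that by auto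
    ultimately have "\<forall>e\<in>insert {u, v} E. card (insert v S \<inter> e) = 1"
      using S(2) by (simp del: Int_insert_left Int_insert_right)
    then show ?thesis using S(1) by (intro exI[of _ "insert v S"]) auto
  qed
qed auto

text \<open>The map \<open>c\<close> sends an edge to its endpoint that was added last.\<close>

lemma grown_embed:
  assumes "grown V E"
    and "\<And>v. v \<in> V \<Longrightarrow> S v \<noteq> {}"
    and "\<And>v. v \<in> V \<Longrightarrow> S v \<subseteq> Z"
    and "\<And>u v x U. {u, v} \<in> E \<Longrightarrow> u \<noteq> v \<Longrightarrow> x \<in> S u \<Longrightarrow> U \<subseteq> Z \<Longrightarrow> finite U \<Longrightarrow> card U \<le> N
          \<Longrightarrow> \<exists>y\<in>S v. adj u v x y \<and> (\<forall>z\<in>U. indep z y)"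
    and "\<And>x y. indep x y \<Longrightarrow> indep y x"
    and "card V \<le> N"
  shows "\<exists>\<phi> c. (\<forall>v\<in>V. \<phi> v \<in> S v) \<and> (\<forall>u\<in>V. \<forall>v\<in>V. u \<noteq> v \<longrightarrow> indep (\<phi> u) (\<phi> v)) \<and>
      inj_on c E \<and> c ` E \<subseteq> V \<and>
      (\<forall>e\<in>E. \<exists>u\<in>V. e = {u, c e} \<and> u \<noteq> c e \<and> adj u (c e) (\<phi> u) (\<phi> (c e)))"
  using assms
proof induction
  case (single r)
  then obtain x where "x \<in> S r" by auto
  then show ?case by (intro exI[of _ "\<lambda>_. x"] exI) auto
next
  case (leaf V E u v)
  have g: "finite V" "\<forall>e\<in>E. e \<subseteq> V" using grown_basic[OF leaf(1)] by auto
  have cV: "card V \<le> N" using leaf.prems(5) g(1) leaf(3) by simp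
  have "\<exists>\<phi> c. (\<forall>v\<in>V. \<phi> v \<in> S v) \<and> (\<forall>u\<in>V. \<forall>v\<in>V. u \<noteq> v \<longrightarrow> indep (\<phi> u) (\<phi> v)) \<and>
      inj_on c E \<and> c ` E \<subseteq> V \<and>
      (\<forall>e\<in>E. \<exists>u\<in>V. e = {u, c e} \<and> u \<noteq> c e \<and> adj u (c e) (\<phi> u) (\<phi> (c e)))"
  proof (rule leaf.IH)
    fix u' v' x U
    assume "{u', v'} \<in> E" "u' \<noteq> v'" "x \<in> S u'" "U \<subseteq> Z" "finite U" "card U \<le> N"
    then show "\<exists>y\<in>S v'. adj u' v' x y \<and> (\<forall>z\<in>U. indep z y)"
      by (intro leaf.prems(3)) simp_all
  next
    fix x y assume "indep x y"
    then show "indep y x" by (rule leaf.prems(4))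
  next
    show "S w \<noteq> {}" if "w \<in> V" for w using leaf.prems(1) that by simp
  next
    show "S w \<subseteq> Z" if "w \<in> V" for w using leaf.prems(2) that by simp
  next
    show "card V \<le> N" by (rule cV)
  qed
  then obtain \<phi> c where \<phi>: "\<forall>v\<in>V. \<phi> v \<in> S v" "\<forall>u\<in>V. \<forall>v\<in>V. u \<noteq> v \<longrightarrow> indep (\<phi> u) (\<phi> v)"
    and c: "inj_on c E" "c ` E \<subseteq> V"
      "\<forall>e\<in>E. \<exists>u\<in>V. e = {u, c e} \<and> u \<noteq> c e \<and> adj u (c e) (\<phi> u) (\<phi> (c e))"
    by (elim exE conjE)
  \<comment> \<open>The image of the tree built so far plays the role of \<open>U\<close>, so the
    vertex found for the new leaf is compatible with all earlier ones at once.\<close>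
  have "\<exists>y\<in>S v. adj u v (\<phi> u) y \<and> (\<forall>z\<in>\<phi> ` V. indep z y)"
  proof (rule leaf.prems(3))
    show "\<phi> ` V \<subseteq> Z" using \<phi>(1) leaf.prems(2) by blast
    show "card (\<phi> ` V) \<le> N" using card_image_le[OF g(1), of \<phi>] \<open>card V \<le> N\<close> by simp
      show "u \<noteq> v" using leaf.hyps by blast
  qed (use leaf.hyps \<phi>(1) g(1) in simp_all)
  then obtain y where y: "y \<in> S v" "adj u v (\<phi> u) y" "\<forall>z\<in>\<phi> ` V. indep z y" by blast
  define \<phi>' where "\<phi>' = \<phi>(v := y)"
  define c' where "c' = c({u, v} := v)"
  have new: "{u, v} \<notin> E" using g(2) leaf(3) by auto
  have uv: "u \<noteq> v" using leaf by auto
  have same: "\<phi>' w = \<phi> w" if "w \<in> V" for w using that leaf(3) by (auto simp: \<phi>'_def)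
  have c_same: "c' e = c e" if "e \<in> E" for e using that new by (auto simp: c'_def)
  have "\<forall>w\<in>insert v V. \<phi>' w \<in> S w" using \<phi>(1) y(1) by (auto simp: \<phi>'_def)
  moreover have "\<forall>w\<in>insert v V. \<forall>z\<in>insert v V. w \<noteq> z \<longrightarrow> indep (\<phi>' w) (\<phi>' z)"
  proof (intro ballI impI)
    fix w z assume wz: "w \<in> insert v V" "z \<in> insert v V" "w \<noteq> z"
    have new_indep: "indep (\<phi> z) y" "indep y (\<phi> z)" if "z \<in> V" for z
      using y(3) leaf.prems(4) that by blast+
    show "indep (\<phi>' w) (\<phi>' z)"
      using wz \<phi>(2) new_indep by (cases "w = v"; cases "z = v") (simp_all add: \<phi>'_def)
  qed
  moreover have "inj_on c' (insert {u, v} E)"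
  proof -
    have "inj_on c' E" using c(1) c_same by (simp cong: inj_on_cong)
    moreover have "c' {u, v} \<notin> c' ` E" using c(2) c_same leaf(3) by (auto simp: c'_def)
    ultimately show ?thesis using new by (simp add: inj_on_insert)
  qed
  moreover have "c' ` insert {u, v} E \<subseteq> insert v V" using c(2) c_same by (auto simp: c'_def)
  moreover have "\<forall>e\<in>insert {u, v} E. \<exists>w\<in>insert v V. e = {w, c' e} \<and> w \<noteq> c' e \<and>
      adj w (c' e) (\<phi>' w) (\<phi>' (c' e))"
  proof
    fix e assume "e \<in> insert {u, v} E"
    then consider "e = {u, v}" | "e \<in> E" by auto
    then show "\<exists>w\<in>insert v V. e = {w, c' e} \<and> w \<noteq> c' e \<and> adj w (c' e) (\<phi>' w) (\<phi>' (c' e))"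
    proof cases
      case 1
      then show ?thesis using leaf(2) y(2) uv by (intro bexI[of _ u]) (auto simp: c'_def \<phi>'_def)
    next
      case 2
      then obtain w where w: "w \<in> V" "e = {w, c e}" "w \<noteq> c e" "adj w (c e) (\<phi> w) (\<phi> (c e))"
        using c(3) by meson
      have "c e \<in> V" using c(2) 2 by auto
      then show ?thesis using w same c_same[OF 2] by (intro bexI[of _ w]) simp_all
    qed
  qed
  ultimately show ?case by (intro exI[of _ \<phi>'] exI[of _ c']) simp
qed

text \<open>Repeatedly delete a vertex lying in at most \<open>d\<close> of the remaining edges.
  Each deletion loses at most \<open>d\<close> edges, so more than \<open>d * card X0\<close> edges
  cannot all disappear. Reading the vertex set of an edge through \<open>vs\<close> covers both
  hypergraphs and relations.\<close>

lemma dense_core: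
  assumes "finite X0" and "finite K" and "\<And>e. e \<in> K \<Longrightarrow> vs e \<subseteq> X0 \<and> vs e \<noteq> {}"
    and "card K > d * card X0"
  shows "\<exists>X\<subseteq>X0. X \<noteq> {} \<and> (\<forall>x\<in>X. card {e\<in>K. vs e \<subseteq> X \<and> x \<in> vs e} > d)"
  using assms
proof (induction "card X0" arbitrary: X0 K)
  case 0
  then show ?case by fastforce
next
  case (Suc k)
  show ?case
  proof (cases "\<forall>x\<in>X0. card {e\<in>K. vs e \<subseteq> X0 \<and> x \<in> vs e} > d")
    case True
    then show ?thesis using Suc by (intro exI[of _ X0]) auto
  next
    case False
    then obtain x where x: "x \<in> X0" "card {e\<in>K. vs e \<subseteq> X0 \<and> x \<in> vs e} \<le> d" by force
    define K' where "K' = {e\<in>K. x \<notin> vs e}"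
    have "K = K' \<union> {e\<in>K. vs e \<subseteq> X0 \<and> x \<in> vs e}" using Suc.prems(3) by (auto simp: K'_def)
    then have "card K \<le> card K' + d"
      using x(2) by (metis (no_types, lifting) add_left_mono card_Un_le le_trans)
    moreover have "card (X0 - {x}) = k" using Suc x by simp
    moreover have "d * card X0 = d * k + d" using Suc.hyps(2) by (metis add.commute mult_Suc_right)
    ultimately have "card K' > d * card (X0 - {x})" using Suc.prems(4) by simp
    then have "\<exists>X\<subseteq>X0 - {x}. X \<noteq> {} \<and> (\<forall>x\<in>X. card {e\<in>K'. vs e \<subseteq> X \<and> x \<in> vs e} > d)"
      using Suc.prems x Suc.hyps(2) by (intro Suc.hyps(1)) (auto simp: K'_def)
    then obtain X where X: "X \<subseteq> X0 - {x}" "X \<noteq> {}"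
      "\<forall>x\<in>X. card {e\<in>K'. vs e \<subseteq> X \<and> x \<in> vs e} > d" by blast
    have "card {e\<in>K. vs e \<subseteq> X \<and> z \<in> vs e} > d" if "z \<in> X" for z
    proof -
      have "{e\<in>K'. vs e \<subseteq> X \<and> z \<in> vs e} \<subseteq> {e\<in>K. vs e \<subseteq> X \<and> z \<in> vs e}"
        by (auto simp: K'_def)
      then have "card {e\<in>K'. vs e \<subseteq> X \<and> z \<in> vs e} \<le> card {e\<in>K. vs e \<subseteq> X \<and> z \<in> vs e}"
        using Suc.prems(2) by (intro card_mono) auto
      then show ?thesis using X(3) that by fastforce
    qed
    then show ?thesis using X by blast
  qed
qed

text \<open>The relation is a bipartite graph between two copies of \<open>X0\<close>, which
  together have \<open>2 * card X0\<close> vertices. Every vertex of the core has a partner on the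
  other side, so neither side is empty.\<close>

lemma dense_relation_core:
  assumes "finite X0" and "R \<subseteq> X0 \<times> X0" and "card R > 2 * d * card X0"
  shows "\<exists>X Y. X \<subseteq> X0 \<and> Y \<subseteq> X0 \<and> X \<noteq> {} \<and> Y \<noteq> {} \<and>
    (\<forall>x\<in>X. card {y\<in>Y. (x, y) \<in> R} > d) \<and> (\<forall>y\<in>Y. card {x\<in>X. (x, y) \<in> R} > d)"
proof -
  define vs :: "'a \<times> 'a \<Rightarrow> ('a + 'a) set" where "vs = (\<lambda>(x, y). {Inl x, Inr y})"
  have finR: "finite R" using assms by (meson finite_SigmaI finite_subset)
  have "\<exists>Z\<subseteq>X0 <+> X0. Z \<noteq> {} \<and> (\<forall>z\<in>Z. card {e\<in>R. vs e \<subseteq> Z \<and> z \<in> vs e} > d)"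
  proof (rule dense_core)
    show "d * card (X0 <+> X0) < card R" using assms by (simp add: card_Plus algebra_simps)
  qed (use assms finR in \<open>auto simp: vs_def\<close>)
  then obtain Z where Z: "Z \<subseteq> X0 <+> X0" "Z \<noteq> {}"
    "\<And>z. z \<in> Z \<Longrightarrow> card {e\<in>R. vs e \<subseteq> Z \<and> z \<in> vs e} > d" by blast
  define X where "X = {x. Inl x \<in> Z}"
  define Y where "Y = {y. Inr y \<in> Z}"
  have XY: "X \<subseteq> X0" "Y \<subseteq> X0" using Z(1) by (auto simp: X_def Y_def)
  then have fin: "finite X" "finite Y" using assms(1) finite_subset by auto
  have 1: "card {y\<in>Y. (x, y) \<in> R} > d" if "x \<in> X" for x
  proof -
    have "{e\<in>R. vs e \<subseteq> Z \<and> Inl x \<in> vs e} \<subseteq> Pair x ` {y\<in>Y. (x, y) \<in> R}"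
      by (auto simp: vs_def Y_def)
    then have "card {e\<in>R. vs e \<subseteq> Z \<and> Inl x \<in> vs e} \<le> card {y\<in>Y. (x, y) \<in> R}"
      using fin by (intro surj_card_le) auto
    then show ?thesis using Z(3)[of "Inl x"] that by (auto simp: X_def)
  qed
  have 2: "card {x\<in>X. (x, y) \<in> R} > d" if "y \<in> Y" for y
  proof -
    have "{e\<in>R. vs e \<subseteq> Z \<and> Inr y \<in> vs e} \<subseteq> (\<lambda>x. (x, y)) ` {x\<in>X. (x, y) \<in> R}"
      by (auto simp: vs_def X_def)
    then have "card {e\<in>R. vs e \<subseteq> Z \<and> Inr y \<in> vs e} \<le> card {x\<in>X. (x, y) \<in> R}"
      using fin by (intro surj_card_le) auto
    then show ?thesis using Z(3)[of "Inr y"] that by (auto simp: Y_def)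
  qed
  have "X \<noteq> {} \<or> Y \<noteq> {}"
  proof -
    obtain z where "z \<in> Z" using Z(2) by auto
    then show ?thesis by (cases z) (auto simp: X_def Y_def)
  qed
  moreover have "Y \<noteq> {}" if "X \<noteq> {}" using 1 that by fastforce
  moreover have "X \<noteq> {}" if "Y \<noteq> {}" using 2 that by fastforce
  ultimately show ?thesis using 1 2 XY by blast
qed

text \<open>Greedy embedding into the core: \<open>V - A\<close> goes to the first coordinates and
  \<open>A\<close> to the second. Each placed vertex rules out at most \<open>D\<close> candidates,
  and more than \<open>card V * D\<close> are on offer.\<close>

lemma dense_relation_embed:
  assumes "grown V E" and A: "\<forall>e\<in>E. card (A \<inter> e) = 1"
    and fin: "finite X0" and R: "R \<subseteq> X0 \<times> X0" and big: "card R > 2 * (card V * D) * card X0"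
    and sym: "\<And>x y. indep x y \<Longrightarrow> indep y x"
    and D: "\<And>x. x \<in> X0 \<Longrightarrow> card {y\<in>X0. \<not> indep x y} \<le> D"
  shows "\<exists>\<phi> c. \<phi> ` V \<subseteq> X0 \<and> (\<forall>u\<in>V. \<forall>v\<in>V. u \<noteq> v \<longrightarrow> indep (\<phi> u) (\<phi> v)) \<and>
      (\<forall>u\<in>V-A. \<forall>v\<in>A. {u, v} \<in> E \<longrightarrow> (\<phi> u, \<phi> v) \<in> R) \<and>
      inj_on c E \<and> c ` E \<subseteq> V \<and> (\<forall>e\<in>E. \<exists>u\<in>V. e = {u, c e} \<and> u \<noteq> c e)"
proof -
  obtain X Y where XY: "X \<subseteq> X0" "Y \<subseteq> X0" "X \<noteq> {}" "Y \<noteq> {}"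
    and dX: "\<And>x. x \<in> X \<Longrightarrow> card {y\<in>Y. (x, y) \<in> R} > card V * D"
    and dY: "\<And>y. y \<in> Y \<Longrightarrow> card {x\<in>X. (x, y) \<in> R} > card V * D"
    using dense_relation_core[OF fin R big] by blast
  define S where "S = (\<lambda>v. if v \<in> A then Y else X)"
  define adj where "adj = (\<lambda>(u::'a) v x y. if v \<in> A then (x, y) \<in> R else (y, x) \<in> R)"
  have bad: "\<exists>y\<in>B. \<forall>z\<in>U. indep z y"
    if "U \<subseteq> X0" "finite U" "card U \<le> card V" "B \<subseteq> X0" "card B > card V * D" for U B
  proof (rule ccontr)
    assume "\<not> ?thesis"
    then have "B \<subseteq> (\<Union>z\<in>U. {y\<in>X0. \<not> indep z y})" using that(4) by blast
    then have "card B \<le> card (\<Union>z\<in>U. {y\<in>X0. \<not> indep z y})"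
      using fin that(2) by (intro card_mono) auto
    also have "\<dots> \<le> (\<Sum>z\<in>U. card {y\<in>X0. \<not> indep z y})" using that(2) by (rule card_UN_le)
    also have "\<dots> \<le> card U * D" using D that(1) by (intro sum_bounded_above[THEN order_trans]) auto
    also have "\<dots> \<le> card V * D" using that(3) by simp
    finally show False using that(5) by simp
  qed
  have cross: "v \<in> A \<longleftrightarrow> u \<notin> A" if "{u, v} \<in> E" "u \<noteq> v" for u v
  proof -
    have "card (A \<inter> {u, v}) = 1" using A that(1) by auto
    then show ?thesis using that(2) by (cases "u \<in> A"; cases "v \<in> A") auto
  qed
  have "\<exists>\<phi> c. (\<forall>v\<in>V. \<phi> v \<in> S v) \<and> (\<forall>u\<in>V. \<forall>v\<in>V. u \<noteq> v \<longrightarrow> indep (\<phi> u) (\<phi> v)) \<and>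
      inj_on c E \<and> c ` E \<subseteq> V \<and>
      (\<forall>e\<in>E. \<exists>u\<in>V. e = {u, c e} \<and> u \<noteq> c e \<and> adj u (c e) (\<phi> u) (\<phi> (c e)))"
  proof (rule grown_embed[OF assms(1), where Z = X0 and N = "card V"])
    fix u v x U
    assume a: "{u, v} \<in> E" "u \<noteq> v" "x \<in> S u" "U \<subseteq> X0" "finite U" "card U \<le> card V"
    show "\<exists>y\<in>S v. adj u v x y \<and> (\<forall>z\<in>U. indep z y)"
    proof (cases "v \<in> A")
      case True
      then have "x \<in> X" using a cross by (auto simp: S_def)
      then have "\<exists>y\<in>{y\<in>Y. (x, y) \<in> R}. \<forall>z\<in>U. indep z y"
        using a XY dX by (intro bad) auto
      then show ?thesis using True by (auto simp: S_def adj_def)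
    next
      case False
      then have "x \<in> Y" using a cross by (auto simp: S_def)
      then have "\<exists>y\<in>{y\<in>X. (y, x) \<in> R}. \<forall>z\<in>U. indep z y"
        using a XY dY by (intro bad) auto
      then show ?thesis using False by (auto simp: S_def adj_def)
    qed
  qed (use XY sym in \<open>auto simp: S_def\<close>)
  then obtain \<phi> c where \<phi>: "\<forall>v\<in>V. \<phi> v \<in> S v" "\<forall>u\<in>V. \<forall>v\<in>V. u \<noteq> v \<longrightarrow> indep (\<phi> u) (\<phi> v)"
    and c: "inj_on c E" "c ` E \<subseteq> V"
      "\<forall>e\<in>E. \<exists>u\<in>V. e = {u, c e} \<and> u \<noteq> c e \<and> adj u (c e) (\<phi> u) (\<phi> (c e))"
    by (elim exE conjE)
  \<comment> \<open>The embedding names an edge by \<open>c e\<close> and its other end. As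
    \<open>adj\<close> orders a pair by membership in \<open>A\<close>, both readings give the same
    pair of \<open>R\<close>.\<close>
  have "(\<phi> u, \<phi> v) \<in> R" if "u \<in> V - A" "v \<in> A" "{u, v} \<in> E" for u v
  proof -
    note uvE = that(3)
    obtain w where w: "{u, v} = {w, c {u, v}}" "adj w (c {u, v}) (\<phi> w) (\<phi> (c {u, v}))"
      using bspec[OF c(3) uvE] by auto
    have "(w = u \<and> c {u, v} = v) \<or> (w = v \<and> c {u, v} = u)"
      using w(1) unfolding doubleton_eq_iff by argo
    then show ?thesis using w(2) that by (auto simp: adj_def)
  qed
  moreover have "\<phi> ` V \<subseteq> X0" using \<phi>(1) XY by (auto simp: S_def split: if_splits)
  moreover have "\<forall>e\<in>E. \<exists>u\<in>V. e = {u, c e} \<and> u \<noteq> c e" using c(3) by meson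
  ultimately show ?thesis using \<phi>(2) c(1,2) by (intro exI[of _ \<phi>] exI[of _ c]) simp
qed

section \<open>Greedy choice of expansion vertices\<close>

lemma distinct_representatives:
  assumes "finite K" and "\<And>e. e \<in> K \<Longrightarrow> card K \<le> card (N e)"
  shows "\<exists>\<psi>. inj_on \<psi> K \<and> (\<forall>e\<in>K. \<psi> e \<in> N e)"
  using assms
proof (induction K)
  case (insert e K)
  then have "\<exists>\<psi>. inj_on \<psi> K \<and> (\<forall>e\<in>K. \<psi> e \<in> N e)" by (intro insert.IH) fastforce
  then obtain \<psi> where \<psi>: "inj_on \<psi> K" "\<forall>e\<in>K. \<psi> e \<in> N e" by blast
  have "card (N e) > card (\<psi> ` K)"
    using insert.prems[of e] insert.hyps card_image_le[OF insert.hyps(1), of \<psi>] by simp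
  then have "\<not> N e \<subseteq> \<psi> ` K" using insert.hyps(1) by (meson card_mono finite_imageI not_le)
  then obtain z where z: "z \<in> N e" "z \<notin> \<psi> ` K" by auto
  moreover have "K - {e} = K" using insert.hyps(2) by simp
  moreover have "inj_on (\<psi>(e := z)) K" using \<psi>(1) insert.hyps(2) by (auto simp: inj_on_def)
  moreover have "\<psi>(e := z) ` K = \<psi> ` K" using insert.hyps(2) by auto
  ultimately have "inj_on (\<psi>(e := z)) (insert e K)"
    unfolding inj_on_insert by (metis fun_upd_same)
  moreover have "\<forall>f\<in>insert e K. (\<psi>(e := z)) f \<in> N f" using \<psi>(2) z(1) by simp
  ultimately show ?case by (intro exI[of _ "\<psi>(e := z)"] conjI)
qed auto

text \<open>Edges in \<open>E1\<close> come with expansion vertices; the other edges choose theirs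
  one after another. Occupied vertices and those still to be chosen number at most
  \<open>card V + card E < 2 * card V\<close>, which explains the threshold in
  \<open>fat\<close>.\<close>

lemma contains_expansionI:
  assumes "finite V" and "finite E" and "card V = Suc (card E)"
    and \<phi>: "inj_on \<phi> V" and "E1 \<subseteq> E"
    and \<psi>: "inj_on \<psi> E1" "\<psi> ` E1 \<inter> \<phi> ` V = {}" "\<And>e. e \<in> E1 \<Longrightarrow> insert (\<psi> e) (\<phi> ` e) \<in> H"
    and fat: "\<And>e. e \<in> E - E1 \<Longrightarrow> 2 * card V \<le> card {z. insert z (\<phi> ` e) \<in> H}"
  shows "contains_expansion H V E"
proof -
  define U where "U = \<phi> ` V \<union> \<psi> ` E1"
  define N where "N = (\<lambda>e. {z. insert z (\<phi> ` e) \<in> H} - U)"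
  have finE1: "finite E1" using assms finite_subset by auto
  have "finite U" using assms finE1 by (simp add: U_def)
  have "card U \<le> card V + card E1"
    unfolding U_def using card_Un_le card_image_le assms(1) finE1 by (meson add_mono le_trans)
  moreover have "card (E - E1) + card E1 = card E"
    using assms(2,5) finE1 by (metis card_Diff_subset card_mono le_add_diff_inverse2)
  ultimately have cU: "card (E - E1) + card U \<le> 2 * card V" using assms(3) by linarith
  have "card (E - E1) \<le> card (N e)" if "e \<in> E - E1" for e
  proof -
    have "card {z. insert z (\<phi> ` e) \<in> H} - card U \<le> card (N e)"
      unfolding N_def using \<open>finite U\<close> by (rule diff_card_le_card_Diff)
    then show ?thesis using fat[OF that] cU by linarith
  qed
  then obtain \<psi>2 where \<psi>2: "inj_on \<psi>2 (E - E1)" "\<And>e. e \<in> E - E1 \<Longrightarrow> \<psi>2 e \<in> N e"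
    using distinct_representatives[of "E - E1" N] assms(2) by auto
  define \<psi>' where "\<psi>' = (\<lambda>e. if e \<in> E1 then \<psi> e else \<psi>2 e)"
  have "inj_on \<psi>' E"
  proof (rule inj_onI)
    fix e f assume ef: "e \<in> E" "f \<in> E" "\<psi>' e = \<psi>' f"
    have new: "\<psi>2 g \<notin> \<psi> ` E1" if "g \<in> E - E1" for g
      using \<psi>2(2)[OF that] by (auto simp: N_def U_def)
    show "e = f"
    proof (cases "e \<in> E1"; cases "f \<in> E1")
      assume "e \<in> E1" "f \<in> E1"
      then show ?thesis using ef(3) inj_onD[OF \<psi>(1)] by (simp add: \<psi>'_def)
    next
      assume "e \<in> E1" "f \<notin> E1"
      then have "\<psi>2 f \<in> \<psi> ` E1" using ef by (simp add: \<psi>'_def rev_image_eqI)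
      then show ?thesis using ef \<open>f \<notin> E1\<close> new[of f] by simp
    next
      assume "e \<notin> E1" "f \<in> E1"
      then have "\<psi>2 e \<in> \<psi> ` E1" using ef by (simp add: \<psi>'_def rev_image_eqI)
      then show ?thesis using ef \<open>e \<notin> E1\<close> new[of e] by simp
    next
      assume "e \<notin> E1" "f \<notin> E1"
      then show ?thesis using ef inj_onD[OF \<psi>2(1)] by (simp add: \<psi>'_def)
    qed
  qed
  moreover have "\<phi> ` V \<inter> \<psi>' ` E = {}"
  proof -
    have "\<psi>' e \<notin> \<phi> ` V" if "e \<in> E" for e
      using that \<psi>(2) \<psi>2(2)[of e] by (auto simp: \<psi>'_def N_def U_def)
    then have "\<psi>' ` E \<subseteq> - \<phi> ` V" by (intro image_subsetI) simp
    then show ?thesis by (simp add: disjoint_eq_subset_Compl Int_commute[of "\<phi> ` V"])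
  qed
  moreover have "\<forall>e\<in>E. insert (\<psi>' e) (\<phi> ` e) \<in> H" using \<psi>(3) \<psi>2(2) by (auto simp: \<psi>'_def N_def)
  ultimately show ?thesis unfolding contains_expansion_def using \<phi>
    by (intro exI[of _ \<phi>] exI[of _ \<psi>'] conjI)
qed

section \<open>Sparse configurations in expansion-free triple systems\<close>

locale expansion_free =
  fixes V :: "'a set" and E :: "'a set set" and A :: "'a set" and n :: nat and H :: "nat set set"
  assumes tree: "is_tree V E"
    and A_sub: "A \<subseteq> V"
    and A_side: "\<forall>e\<in>E. card (A \<inter> e) = 1"
    and triples: "three_graph n H"
    and free: "\<not> contains_expansion H V E"
begin

section \<open>Links, fat pairs and tokens\<close>

definition link :: "nat \<Rightarrow> nat \<Rightarrow> nat set" where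
  "link x y = {z. {x, y, z} \<in> H}"

definition fat :: "nat \<Rightarrow> nat \<Rightarrow> bool" where
  "fat x y \<longleftrightarrow> 2 * card V \<le> card (link x y)"

text \<open>Possible expansion vertices for a tree edge placed on \<open>xy\<close>, owned by
  \<open>x\<close>: they are fat neighbours of \<open>x\<close>, so the definition is not symmetric
  in \<open>x\<close> and \<open>y\<close>.\<close>

definition token :: "nat set \<Rightarrow> nat \<Rightarrow> nat \<Rightarrow> nat set" where
  "token Q x y = {b\<in>Q. fat x b \<and> {x, y, b} \<in> H}"

text \<open>The closed fat neighbourhood contains \<open>x\<close> and all tokens it owns. Disjoint
  neighbourhoods therefore keep images and tokens of different tree vertices apart.\<close>

definition nbh :: "nat set \<Rightarrow> nat \<Rightarrow> nat set" where
  "nbh Q x = insert x {b\<in>Q. fat x b}"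

lemma grown: "grown V E"
  using tree by (rule tree_grown)

lemma finV: "finite V" and finE: "finite E" and cardV: "card V = Suc (card E)"
  using grown_basic[OF grown] by auto

lemma E_sub: "e \<in> E \<Longrightarrow> e \<subseteq> V"
  using grown_basic[OF grown] by auto

lemma finH: "finite H"
proof -
  have "H \<subseteq> Pow {..<n}" using triples by (auto simp: three_graph_def)
  then show ?thesis using finite_subset by blast
qed

lemma edge_bound: "e \<in> H \<Longrightarrow> e \<subseteq> {..<n}" and edge_card: "e \<in> H \<Longrightarrow> card e = 3"
  using triples by (auto simp: three_graph_def)

lemma edge_vertices:
  assumes "{x, y, z} \<in> H"
  shows "x \<noteq> y" "x \<noteq> z" "y \<noteq> z" "x < n" "y < n" "z < n"
  using edge_card[OF assms] edge_bound[OF assms] by (auto simp: card_insert_if split: if_splits)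

lemma edge_cases:
  assumes "e \<in> H"
  obtains x y z where "e = {x, y, z}" "x \<noteq> y" "x \<noteq> z" "y \<noteq> z"
  using edge_card[OF assms] card_3_iff[of e] by auto

lemma third_vertex:
  assumes "e \<in> H" and "x \<in> e" and "y \<in> e" and "x \<noteq> y"
  obtains z where "e = {x, y, z}"
proof -
  have "card (e - {x, y}) = 1"
    using assms edge_card[OF assms(1)] by (subst card_Diff_subset) auto
  then obtain z where "e - {x, y} = {z}" by (auto simp: card_1_singleton_iff)
  then have "e = {x, y, z}" using assms by blast
  then show thesis by (rule that)
qed

lemma link_sub: "link x y \<subseteq> {..<n}"
  using edge_vertices by (auto simp: link_def)

lemma fin_link: "finite (link x y)"
  using link_sub finite_subset by blast

lemma link_sym: "link x y = link y x"
  by (simp add: link_def insert_commute)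

lemma fat_sym: "fat x y \<longleftrightarrow> fat y x"
  by (simp add: fat_def link_sym)

lemma fat_vertices:
  assumes "fat x y"
  shows "x \<noteq> y" "x < n" "y < n"
proof -
  have "card (link x y) > 0" using assms cardV by (simp add: fat_def)
  then have "link x y \<noteq> {}" using card.empty by fastforce
  then obtain z where "z \<in> link x y" by auto
  then show "x \<noteq> y" "x < n" "y < n" using edge_vertices by (auto simp: link_def)
qed

lemma link_image: "{z. insert z (\<phi> ` {u, v}) \<in> H} = link (\<phi> u) (\<phi> v)"
proof -
  have "insert z (\<phi> ` {u, v}) = {\<phi> u, \<phi> v, z}" for z by auto
  then show ?thesis by (simp add: link_def)
qed

lemma edge_split:
  assumes "e \<in> E"
  shows "\<exists>b\<in>V - A. \<exists>a\<in>A. e = {b, a}"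
proof -
  have "card e = 2" using tree assms by (auto simp: is_tree_def graph_def)
  then obtain u v where uv: "e = {u, v}" "u \<noteq> v" using card_2_iff by metis
  have "card (A \<inter> {u, v}) = 1" using A_side assms uv by auto
  then have "(u \<in> A \<and> v \<notin> A) \<or> (u \<notin> A \<and> v \<in> A)"
    using uv(2) by (cases "u \<in> A"; cases "v \<in> A") auto
  then show ?thesis using uv(1) E_sub[OF assms] by (auto simp: insert_commute)
qed

text \<open>A denser fat relation would contain a copy of the tree; independence is just
  \<open>\<noteq>\<close>, so \<open>D = 1\<close>. On fat pairs all expansion vertices can be
  chosen at the end, hence \<open>E1\<close> is empty.\<close>

lemma card_fat: "card {(x, y). fat x y} \<le> 2 * card V * n"
proof (rule ccontr)
  assume "\<not> ?thesis"
  then have big: "card {(x, y). fat x y} > 2 * (card V * 1) * card {..<n}" by simp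
  have "{y\<in>{..<n}. \<not> x \<noteq> y} \<subseteq> {x}" for x by auto
  then have D: "card {y\<in>{..<n}. \<not> x \<noteq> y} \<le> 1" for x
    using card_mono[of "{x}"] by (metis card.empty card.insert finite.emptyI finite.insertI insert_absorb insert_not_empty One_nat_def)
  have "{(x, y). fat x y} \<subseteq> {..<n} \<times> {..<n}" using fat_vertices by auto
  from dense_relation_embed[OF grown A_side _ this big, of "(\<noteq>)"] D
  obtain \<phi> where \<phi>: "\<phi> ` V \<subseteq> {..<n}" "\<forall>u\<in>V. \<forall>v\<in>V. u \<noteq> v \<longrightarrow> \<phi> u \<noteq> \<phi> v"
    "\<forall>u\<in>V-A. \<forall>v\<in>A. {u, v} \<in> E \<longrightarrow> fat (\<phi> u) (\<phi> v)" by auto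
  have "contains_expansion H V E"
  proof (rule contains_expansionI[where ?E1.0 = "{}" and \<phi> = \<phi>])
    show "inj_on \<phi> V" using \<phi>(2) by (meson inj_onI)
    fix e assume "e \<in> E - {}"
    then obtain b a where "b \<in> V - A" "a \<in> A" "e = {b, a}" "e \<in> E" using edge_split by blast
    then show "2 * card V \<le> card {z. insert z (\<phi> ` e) \<in> H}"
      using \<phi>(3) link_image[of \<phi> b a] by (simp add: fat_def)
  qed (use finV finE cardV in auto)
  then show False using free by simp
qed

text \<open>In the core every degree exceeds \<open>4 * m^2\<close>. A tree vertex is placed
  together with the expansion vertex of the edge to its parent. At most \<open>2 * m\<close>
  vertices are in use, and each shares fewer than \<open>2 * m\<close> of these edges with the
  current vertex because the pair is light, so a fresh edge remains.\<close>

lemma card_light_edges: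
  "card {e\<in>H. \<forall>x\<in>e. \<forall>y\<in>e. \<not> fat x y} \<le> 4 * (card V)\<^sup>2 * n"
proof (rule ccontr)
  define K where "K = {e\<in>H. \<forall>x\<in>e. \<forall>y\<in>e. \<not> fat x y}"
  define m where "m = card V"
  assume "\<not> ?thesis"
  then have big: "card K > 4 * m\<^sup>2 * card {..<n}" by (simp add: K_def m_def)
  have finK: "finite K" using finH by (simp add: K_def)
  have "\<exists>X\<subseteq>{..<n}. X \<noteq> {} \<and> (\<forall>x\<in>X. card {e\<in>K. id e \<subseteq> X \<and> x \<in> id e} > 4 * m\<^sup>2)"
  proof (rule dense_core[OF _ finK _ big])
    fix e assume "e \<in> K"
    then have "e \<subseteq> {..<n}" "card e = 3" using edge_bound edge_card by (auto simp: K_def)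
    then show "id e \<subseteq> {..<n} \<and> id e \<noteq> {}" by auto
  qed simp
  then obtain X where X: "X \<subseteq> {..<n}" "X \<noteq> {}"
    "\<And>x. x \<in> X \<Longrightarrow> card {e\<in>K. e \<subseteq> X \<and> x \<in> e} > 4 * m\<^sup>2" by auto
  \<comment> \<open>A pair consists of the image of a tree vertex and the expansion vertex of the
    edge that attached it; for the root the second entry is arbitrary. Accordingly
    \<open>adj\<close> uses only the first entry of the parent.\<close>
  define indep where "indep = (\<lambda>(p :: nat \<times> nat) (q :: nat \<times> nat). {fst p, snd p} \<inter> {fst q, snd q} = {})"
  define adj where "adj = (\<lambda>(u::'a) (v::'a) (p :: nat \<times> nat) (q :: nat \<times> nat). {fst p, fst q, snd q} \<in> H)"
  have "\<exists>\<phi> c. (\<forall>v\<in>V. \<phi> v \<in> X \<times> UNIV) \<and> (\<forall>u\<in>V. \<forall>v\<in>V. u \<noteq> v \<longrightarrow> indep (\<phi> u) (\<phi> v)) \<and>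
      inj_on c E \<and> c ` E \<subseteq> V \<and>
      (\<forall>e\<in>E. \<exists>u\<in>V. e = {u, c e} \<and> u \<noteq> c e \<and> adj u (c e) (\<phi> u) (\<phi> (c e)))"
  proof (rule grown_embed[OF grown, where Z = UNIV and N = m])
    fix u v :: 'a and p :: "nat \<times> nat" and U :: "(nat \<times> nat) set"
    assume a: "p \<in> X \<times> UNIV" "finite U" "card U \<le> m"
    define x where "x = fst p"
    define T where "T = fst ` U \<union> snd ` U"
    have xX: "x \<in> X" using a by (auto simp: x_def)
    have finT: "finite T" using a by (simp add: T_def)
    have "card T \<le> card (fst ` U) + card (snd ` U)" unfolding T_def by (rule card_Un_le)
    also have "\<dots> \<le> m + m"
      using a by (intro add_mono) (meson card_image_le le_trans)+
    finally have cT: "card (T - {x}) \<le> 2 * m"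
      using card_mono[OF finT, of "T - {x}"] by auto
    \<comment> \<open>The vertex \<open>x\<close> is exempt from the forbidden set, as the new edge
      has to pass through it.\<close>
    have "\<exists>e\<in>K. e \<subseteq> X \<and> x \<in> e \<and> e \<inter> (T - {x}) = {}"
    proof (rule ccontr)
      assume "\<not> ?thesis"
      then have "{e\<in>K. e \<subseteq> X \<and> x \<in> e} \<subseteq> (\<Union>t\<in>T - {x}. {e\<in>K. x \<in> e \<and> t \<in> e})" by blast
      then have "card {e\<in>K. e \<subseteq> X \<and> x \<in> e} \<le> card (\<Union>t\<in>T - {x}. {e\<in>K. x \<in> e \<and> t \<in> e})"
        using finT finK by (intro card_mono) auto
      also have "\<dots> \<le> (\<Sum>t\<in>T - {x}. card {e\<in>K. x \<in> e \<and> t \<in> e})"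
        using finT by (intro card_UN_le) auto
      also have "\<dots> \<le> (\<Sum>t\<in>T - {x}. 2 * m)"
      proof (rule sum_mono)
        fix t assume t: "t \<in> T - {x}"
        show "card {e\<in>K. x \<in> e \<and> t \<in> e} \<le> 2 * m"
        proof (cases "{e\<in>K. x \<in> e \<and> t \<in> e} = {}")
          case False
          then have "\<not> fat x t" by (auto simp: K_def)
          have "{e\<in>K. x \<in> e \<and> t \<in> e} \<subseteq> (\<lambda>z. {x, t, z}) ` link x t"
          proof
            fix e assume "e \<in> {e\<in>K. x \<in> e \<and> t \<in> e}"
            then have e: "e \<in> H" "x \<in> e" "t \<in> e" by (auto simp: K_def)
            then obtain z where "e = {x, t, z}" using t third_vertex[of e x t] by auto
            then show "e \<in> (\<lambda>z. {x, t, z}) ` link x t" using e by (auto simp: link_def)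
          qed
          then have "card {e\<in>K. x \<in> e \<and> t \<in> e} \<le> card (link x t)"
            using fin_link by (intro surj_card_le)
          then show ?thesis using \<open>\<not> fat x t\<close> by (simp add: fat_def m_def)
        next
          case True
          then show ?thesis by (simp only: card.empty)
        qed
      qed
      also have "\<dots> \<le> 4 * m\<^sup>2" using cT by (simp add: power2_eq_square)
      finally show False using X(3)[OF xX] by simp
    qed
    then obtain e where e: "e \<in> H" "e \<subseteq> X" "x \<in> e" "e \<inter> (T - {x}) = {}" by (auto simp: K_def)
    then obtain y z where yz: "e = {x, y, z}" "x \<noteq> y" "x \<noteq> z" "y \<noteq> z"
      by (elim edge_cases) (auto simp: insert_commute)
    have "indep q (y, z)" if "q \<in> U" for q
      using e(4) yz that by (auto simp: indep_def T_def)
    then show "\<exists>q\<in>X \<times> UNIV. adj u v p q \<and> (\<forall>r\<in>U. indep r q)"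
      using e yz by (intro bexI[of _ "(y, z)"]) (auto simp: adj_def x_def)
  qed (use X(2) in \<open>auto simp: indep_def m_def\<close>)
  then obtain \<phi> c where \<phi>': "\<forall>u\<in>V. \<forall>v\<in>V. u \<noteq> v \<longrightarrow> indep (\<phi> u) (\<phi> v)"
    and c: "inj_on c E" "c ` E \<subseteq> V"
      "\<forall>e\<in>E. \<exists>u\<in>V. e = {u, c e} \<and> u \<noteq> c e \<and> adj u (c e) (\<phi> u) (\<phi> (c e))"
    by (elim exE conjE)
  have \<phi>: "\<And>u v. u \<in> V \<Longrightarrow> v \<in> V \<Longrightarrow> u \<noteq> v \<Longrightarrow> indep (\<phi> u) (\<phi> v)"
    using \<phi>' by simp
  have ceV: "c e \<in> V" if "e \<in> E" for e using c(2) that by auto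
  have "contains_expansion H V E"
  proof (rule contains_expansionI[where ?E1.0 = E and \<phi> = "fst \<circ> \<phi>" and \<psi> = "\<lambda>e. snd (\<phi> (c e))"])
    show "inj_on (fst \<circ> \<phi>) V"
      using \<phi> by (intro inj_onI) (force simp: indep_def)
    show "inj_on (\<lambda>e. snd (\<phi> (c e))) E"
    proof (rule inj_onI)
      fix e f assume "e \<in> E" "f \<in> E" "snd (\<phi> (c e)) = snd (\<phi> (c f))"
      then have "c e = c f" using \<phi>[OF ceV ceV] by (force simp: indep_def)
      then show "e = f" using c(1) \<open>e \<in> E\<close> \<open>f \<in> E\<close> by (auto dest: inj_onD)
    qed
    \<comment> \<open>Independence compares different tree vertices only. For \<open>v = c e\<close>
      the two entries differ because they lie in one edge of \<open>H\<close>.\<close>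
    have "snd (\<phi> (c e)) \<noteq> fst (\<phi> v)" if eE: "e \<in> E" and "v \<in> V" for e v
    proof (cases "v = c e")
      case True
      obtain u where "adj u (c e) (\<phi> u) (\<phi> (c e))" using bspec[OF c(3) eE] by auto
      then show ?thesis using edge_vertices True by (metis adj_def)
    next
      case False
      then show ?thesis using \<phi>[OF that(2) ceV[OF eE]] by (auto simp: indep_def)
    qed
    then show "(\<lambda>e. snd (\<phi> (c e))) ` E \<inter> (fst \<circ> \<phi>) ` V = {}" by auto
    fix e assume "e \<in> E"
    then obtain u where "e = {u, c e}" "adj u (c e) (\<phi> u) (\<phi> (c e))" using bspec[OF c(3)] by blast
    moreover have "insert (snd (\<phi> (c e))) ((fst \<circ> \<phi>) ` {u, c e}) =
        {fst (\<phi> u), fst (\<phi> (c e)), snd (\<phi> (c e))}" by auto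
    ultimately show "insert (snd (\<phi> (c e))) ((fst \<circ> \<phi>) ` e) \<in> H"
      unfolding adj_def by metis
  qed (use finV finE cardV in auto)
  then show False using free by simp
qed

section \<open>Pairs with many tokens\<close>

lemma token_sub:
  assumes "b \<in> token Q x y"
  shows "b \<in> nbh Q x" "b \<noteq> x" "b \<in> Q" "{x, y, b} \<in> H"
  using assms fat_vertices(1) by (auto simp: token_def nbh_def)

text \<open>Closed neighbourhoods meet only at distance at most two in the fat graph on
  \<open>Q\<close>, whose degrees are at most \<open>M\<close>.\<close>

lemma card_dependent:
  assumes "Q \<subseteq> {..<n}" and "\<And>x. x \<in> Q \<Longrightarrow> card {b\<in>Q. fat x b} \<le> M" and "x \<in> Q"
  shows "card {y\<in>Q. \<not> nbh Q x \<inter> nbh Q y = {}} \<le> (M + 1)\<^sup>2"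
proof -
  have fin: "finite Q" using assms(1) finite_subset by blast
  have c: "card (nbh Q z) \<le> M + 1" and f: "finite (nbh Q z)" if "z \<in> Q" for z
    using assms(2)[OF that] fin by (auto simp: nbh_def card_insert_if)
  have sub: "nbh Q x \<subseteq> Q" using assms(3) by (auto simp: nbh_def)
  have "{y\<in>Q. \<not> nbh Q x \<inter> nbh Q y = {}} \<subseteq> (\<Union>z\<in>nbh Q x. nbh Q z)"
    using fat_sym by (auto simp: nbh_def)
  then have "card {y\<in>Q. \<not> nbh Q x \<inter> nbh Q y = {}} \<le> card (\<Union>z\<in>nbh Q x. nbh Q z)"
    using f sub assms(3) by (intro card_mono) auto
  also have "\<dots> \<le> (\<Sum>z\<in>nbh Q x. card (nbh Q z))"
    using f assms(3) by (intro card_UN_le)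
  also have "\<dots> \<le> card (nbh Q x) * (M + 1)"
    using c sub by (intro sum_bounded_above[THEN order_trans]) auto
  also have "\<dots> \<le> (M + 1) * (M + 1)" using c assms(3) by (intro mult_right_mono) auto
  finally show ?thesis by (simp add: power2_eq_square)
qed

text \<open>Every edge of the tree takes a token of its later endpoint.\<close>

lemma card_two_sided:
  assumes Q: "Q \<subseteq> {..<n}" and deg: "\<And>x. x \<in> Q \<Longrightarrow> card {b\<in>Q. fat x b} \<le> M"
  shows "card {(x, y). x \<in> Q \<and> y \<in> Q \<and> token Q x y \<noteq> {} \<and> token Q y x \<noteq> {}}
    \<le> 2 * (card V * (M + 1)\<^sup>2) * n"
proof (rule ccontr)
  define R where "R = {(x, y). x \<in> Q \<and> y \<in> Q \<and> token Q x y \<noteq> {} \<and> token Q y x \<noteq> {}}"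
  assume "\<not> ?thesis"
  then have "card R > 2 * (card V * (M + 1)\<^sup>2) * n" by (simp add: R_def)
  moreover have "card Q \<le> n" using card_mono[OF _ Q] by simp
  ultimately have big: "card R > 2 * (card V * (M + 1)\<^sup>2) * card Q"
    by (meson le_less_trans mult_le_mono2)
  have finQ: "finite Q" using Q finite_subset by blast
  have RQ: "R \<subseteq> Q \<times> Q" by (auto simp: R_def)
  have "\<exists>\<phi> c. \<phi> ` V \<subseteq> Q \<and> (\<forall>u\<in>V. \<forall>v\<in>V. u \<noteq> v \<longrightarrow> nbh Q (\<phi> u) \<inter> nbh Q (\<phi> v) = {}) \<and>
      (\<forall>u\<in>V-A. \<forall>v\<in>A. {u, v} \<in> E \<longrightarrow> (\<phi> u, \<phi> v) \<in> R) \<and>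
      inj_on c E \<and> c ` E \<subseteq> V \<and> (\<forall>e\<in>E. \<exists>u\<in>V. e = {u, c e} \<and> u \<noteq> c e)"
    using card_dependent[OF Q deg]
    by (intro dense_relation_embed[OF grown A_side finQ RQ big]) auto
  then obtain \<phi> c
    where \<phi>': "\<forall>u\<in>V. \<forall>v\<in>V. u \<noteq> v \<longrightarrow> nbh Q (\<phi> u) \<inter> nbh Q (\<phi> v) = {}"
      "\<forall>u\<in>V-A. \<forall>v\<in>A. {u, v} \<in> E \<longrightarrow> (\<phi> u, \<phi> v) \<in> R"
    and c: "inj_on c E" "c ` E \<subseteq> V" "\<forall>e\<in>E. \<exists>u\<in>V. e = {u, c e} \<and> u \<noteq> c e"
    by (elim exE conjE)
  have \<phi>: "\<And>u v. u \<in> V \<Longrightarrow> v \<in> V \<Longrightarrow> u \<noteq> v \<Longrightarrow> nbh Q (\<phi> u) \<inter> nbh Q (\<phi> v) = {}"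
      "\<And>u v. u \<in> V - A \<Longrightarrow> v \<in> A \<Longrightarrow> {u, v} \<in> E \<Longrightarrow> (\<phi> u, \<phi> v) \<in> R"
    using \<phi>' by simp_all
  have ceV: "c e \<in> V" if "e \<in> E" for e using c(2) that by auto
  \<comment> \<open>Both ends of a pair in \<open>R\<close> own a token, so it does not matter which
    endpoint of \<open>e\<close> was added last.\<close>
  have "\<exists>t. \<exists>u. e = {u, c e} \<and> t \<in> token Q (\<phi> (c e)) (\<phi> u)" if eE: "e \<in> E" for e
  proof -
    obtain b a where ba: "b \<in> V - A" "a \<in> A" "e = {b, a}" using edge_split[OF eE] by blast
    then have "(\<phi> b, \<phi> a) \<in> R" using \<phi>(2) eE by blast
    then obtain s t where st: "s \<in> token Q (\<phi> b) (\<phi> a)" "t \<in> token Q (\<phi> a) (\<phi> b)"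
      by (auto simp: R_def)
    obtain u where u: "e = {u, c e}" using bspec[OF c(3) eE] by auto
    then have "c e = a \<and> e = {b, c e} \<or> c e = b \<and> e = {a, c e}"
      using ba(3) by (auto simp: doubleton_eq_iff)
    then show ?thesis using st by metis
  qed
  then obtain \<psi> where \<psi>: "\<And>e. e \<in> E \<Longrightarrow> \<exists>u. e = {u, c e} \<and> \<psi> e \<in> token Q (\<phi> (c e)) (\<phi> u)"
    by metis
  have \<psi>_nbh: "\<psi> e \<in> nbh Q (\<phi> (c e))" "\<psi> e \<noteq> \<phi> (c e)" if "e \<in> E" for e
    using \<psi>[OF that] token_sub by blast+
  have "contains_expansion H V E"
  proof (rule contains_expansionI[where ?E1.0 = E and \<phi> = \<phi> and \<psi> = \<psi>])
    show "inj_on \<phi> V"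
    proof (rule inj_onI)
      fix u v assume "u \<in> V" "v \<in> V" "\<phi> u = \<phi> v"
      then show "u = v" using \<phi>(1)[of u v] by (auto simp: nbh_def)
    qed
    \<comment> \<open>Tokens with different owners lie in disjoint neighbourhoods, and
      \<open>c\<close> gives every edge its own owner.\<close>
    show "inj_on \<psi> E"
    proof (rule inj_onI)
      fix e f assume ef: "e \<in> E" "f \<in> E" "\<psi> e = \<psi> f"
      then have "c e = c f"
        using \<phi>(1)[OF ceV[OF ef(1)] ceV[OF ef(2)]] \<psi>_nbh(1)[OF ef(1)] \<psi>_nbh(1)[OF ef(2)] by auto
      then show "e = f" using c(1) ef by (auto dest: inj_onD)
    qed
    have "\<psi> e \<noteq> \<phi> v" if "e \<in> E" "v \<in> V" for e v
      using \<phi>(1)[OF ceV[OF that(1)] that(2)] \<psi>_nbh[OF that(1)]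
      by (cases "c e = v") (auto simp: nbh_def)
    then show "\<psi> ` E \<inter> \<phi> ` V = {}" by auto
    fix e assume "e \<in> E"
    then obtain u where u: "e = {u, c e}" "\<psi> e \<in> token Q (\<phi> (c e)) (\<phi> u)" using \<psi> by blast
    have "{\<phi> (c e), \<phi> u, \<psi> e} \<in> H" using token_sub(4)[OF u(2)] .
    moreover have "insert (\<psi> e) (\<phi> ` {u, c e}) = {\<phi> (c e), \<phi> u, \<psi> e}" by auto
    ultimately show "insert (\<psi> e) (\<phi> ` e) \<in> H" using u(1) by metis
  qed (use finV finE cardV in auto)
  then show False using free by simp
qed

text \<open>Here \<open>card F0\<close> vertices of \<open>A\<close> are sent to \<open>F0\<close>; a vertex outside \<open>A\<close> has at most
  \<open>card A - card F0\<close> further neighbours, and all those edges take tokens of that vertex.\<close>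

lemma card_one_sided:
  assumes Q: "Q \<subseteq> {..<n}" and deg: "\<And>x. x \<in> Q \<Longrightarrow> card {b\<in>Q. fat x b} \<le> M"
    and F0: "finite F0" "F0 \<inter> Q = {}" "card F0 \<le> card A"
  shows "card {(x, y). x \<in> Q \<and> y \<in> Q \<and> (\<forall>w\<in>F0. fat x w \<and> fat y w) \<and>
      card A \<le> card F0 + card (token Q x y)} \<le> 2 * (card V * (M + 1)\<^sup>2) * n"
proof (rule ccontr)
  define R where "R = {(x, y). x \<in> Q \<and> y \<in> Q \<and> (\<forall>w\<in>F0. fat x w \<and> fat y w) \<and>
      card A \<le> card F0 + card (token Q x y)}"
  assume "\<not> ?thesis"
  then have "card R > 2 * (card V * (M + 1)\<^sup>2) * n" by (simp add: R_def)
  moreover have "card Q \<le> n" using card_mono[OF _ Q] by simp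
  ultimately have big: "card R > 2 * (card V * (M + 1)\<^sup>2) * card Q"
    by (meson le_less_trans mult_le_mono2)
  have finQ: "finite Q" using Q finite_subset by blast
  have RQ: "R \<subseteq> Q \<times> Q" by (auto simp: R_def)
  have "\<exists>\<phi> c. \<phi> ` V \<subseteq> Q \<and> (\<forall>u\<in>V. \<forall>v\<in>V. u \<noteq> v \<longrightarrow> nbh Q (\<phi> u) \<inter> nbh Q (\<phi> v) = {}) \<and>
      (\<forall>u\<in>V-A. \<forall>v\<in>A. {u, v} \<in> E \<longrightarrow> (\<phi> u, \<phi> v) \<in> R) \<and>
      inj_on c E \<and> c ` E \<subseteq> V \<and> (\<forall>e\<in>E. \<exists>u\<in>V. e = {u, c e} \<and> u \<noteq> c e)"
    using card_dependent[OF Q deg]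
    by (intro dense_relation_embed[OF grown A_side finQ RQ big]) auto
  then obtain \<phi> where \<phi>Q: "\<phi> ` V \<subseteq> Q"
    and \<phi>': "\<forall>u\<in>V. \<forall>v\<in>V. u \<noteq> v \<longrightarrow> nbh Q (\<phi> u) \<inter> nbh Q (\<phi> v) = {}"
      "\<forall>u\<in>V-A. \<forall>v\<in>A. {u, v} \<in> E \<longrightarrow> (\<phi> u, \<phi> v) \<in> R"
    by (elim exE conjE)
  have \<phi>: "\<And>u v. u \<in> V \<Longrightarrow> v \<in> V \<Longrightarrow> u \<noteq> v \<Longrightarrow> nbh Q (\<phi> u) \<inter> nbh Q (\<phi> v) = {}"
      "\<And>u v. u \<in> V - A \<Longrightarrow> v \<in> A \<Longrightarrow> {u, v} \<in> E \<Longrightarrow> (\<phi> u, \<phi> v) \<in> R"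
    using \<phi>' by simp_all
  have \<phi>_inj: "u = v" if "u \<in> V" "v \<in> V" "\<phi> u = \<phi> v" for u v
    using \<phi>(1)[of u v] that by (auto simp: nbh_def)
  have finA: "finite A" using A_sub finV finite_subset by blast
  obtain A' where A': "A' \<subseteq> A" "card A' = card F0"
    using obtain_subset_with_card_n[OF F0(3)] by metis
  have finA': "finite A'" using A' finA finite_subset by blast
  obtain h where h: "bij_betw h A' F0"
    using finite_same_card_bij[OF finA' F0(1) A'(2)] by blast
  \<comment> \<open>The vertices of \<open>A'\<close> move to \<open>F0\<close>. By the definition
    of \<open>R\<close>, their neighbours have images that are fat to every element of
    \<open>F0\<close>, so any bijection \<open>h\<close> will do.\<close>
  define \<phi>' where "\<phi>' = (\<lambda>v. if v \<in> A' then h v else \<phi> v)"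
  have hF: "h v \<in> F0" if "v \<in> A'" for v using h that by (auto simp: bij_betw_def)
  have \<phi>v: "\<phi> v \<in> Q" if "v \<in> V" for v using \<phi>Q that by auto
  have F0Q: "w \<notin> Q" if "w \<in> F0" for w using F0(2) that by auto
  obtain b a where ba: "\<And>e. e \<in> E \<Longrightarrow> b e \<in> V - A \<and> a e \<in> A \<and> e = {b e, a e}"
    using edge_split by metis
  have inR: "(\<phi> (b e), \<phi> (a e)) \<in> R" if "e \<in> E" for e
    using \<phi>(2)[of "b e" "a e"] ba[OF that] that by metis
  \<comment> \<open>These are the edges whose end in \<open>A\<close> stays in \<open>Q\<close>.
    They need tokens; all other edges become fat pairs.\<close>
  define E1 where "E1 = {e\<in>E. a e \<notin> A'}"
  define N where "N = (\<lambda>e. token Q (\<phi> (b e)) (\<phi> (a e)))"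
  \<comment> \<open>Tokens are chosen separately around each vertex \<open>v\<close> outside
    \<open>A\<close>; disjoint neighbourhoods then separate the choices for different
    \<open>v\<close>.\<close>
  have "\<exists>\<psi>. inj_on \<psi> {e\<in>E1. b e = v} \<and> (\<forall>e\<in>{e\<in>E1. b e = v}. \<psi> e \<in> N e)" for v
  proof (rule distinct_representatives)
    show "finite {e\<in>E1. b e = v}" using finE by (simp add: E1_def)
    fix e assume e: "e \<in> {e\<in>E1. b e = v}"
    have "inj_on a {e\<in>E1. b e = v}"
    proof (rule inj_onI)
      fix e f assume "e \<in> {e\<in>E1. b e = v}" "f \<in> {e\<in>E1. b e = v}" "a e = a f"
      then show "e = f" using ba[of e] ba[of f] by (auto simp: E1_def)
    qed
    moreover have "a ` {e\<in>E1. b e = v} \<subseteq> A - A'" using ba by (auto simp: E1_def)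
    ultimately have "card {e\<in>E1. b e = v} \<le> card (A - A')"
      using finA by (intro card_inj_on_le[of a]) auto
    also have "\<dots> = card A - card F0" using A' finA' by (simp add: card_Diff_subset)
    also have "\<dots> \<le> card (N e)" using inR[of e] e by (auto simp: R_def N_def E1_def)
    finally show "card {e\<in>E1. b e = v} \<le> card (N e)" .
  qed
  then have "\<forall>v. \<exists>\<psi>. inj_on \<psi> {e\<in>E1. b e = v} \<and> (\<forall>e\<in>{e\<in>E1. b e = v}. \<psi> e \<in> N e)" by blast
  from choice[OF this] obtain \<psi>0 where \<psi>0: "\<And>v. inj_on (\<psi>0 v) {e\<in>E1. b e = v}"
    "\<And>v e. e \<in> E1 \<Longrightarrow> b e = v \<Longrightarrow> \<psi>0 v e \<in> N e" by auto
  define \<psi> where "\<psi> = (\<lambda>e. \<psi>0 (b e) e)"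
  have \<psi>N: "\<psi> e \<in> N e" if "e \<in> E1" for e using \<psi>0(2) that by (simp add: \<psi>_def)
  have \<psi>_nbh: "\<psi> e \<in> nbh Q (\<phi> (b e))" "\<psi> e \<noteq> \<phi> (b e)" "\<psi> e \<in> Q" if "e \<in> E1" for e
    using token_sub[of "\<psi> e" Q] \<psi>N[OF that] by (auto simp: N_def)
  have beV: "b e \<in> V" if "e \<in> E1" for e using ba that by (auto simp: E1_def)
  have "contains_expansion H V E"
  proof (rule contains_expansionI[where ?E1.0 = E1 and \<phi> = \<phi>' and \<psi> = \<psi>])
    show "inj_on \<phi>' V"
    proof (rule inj_onI)
      fix u v assume uv: "u \<in> V" "v \<in> V" "\<phi>' u = \<phi>' v"
      show "u = v"
      proof (cases "u \<in> A'"; cases "v \<in> A'")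
        assume "u \<in> A'" "v \<in> A'"
        then show ?thesis using uv(3) bij_betw_imp_inj_on[OF h] by (auto simp: \<phi>'_def dest: inj_onD)
      next
        assume "u \<in> A'" "v \<notin> A'"
        then show ?thesis using uv hF[of u] F0Q \<phi>v[of v] by (auto simp: \<phi>'_def)
      next
        assume "u \<notin> A'" "v \<in> A'"
        then show ?thesis using uv hF[of v] F0Q \<phi>v[of u] by (auto simp: \<phi>'_def)
      next
        assume "u \<notin> A'" "v \<notin> A'"
        then show ?thesis using uv \<phi>_inj by (auto simp: \<phi>'_def)
      qed
    qed
    show "E1 \<subseteq> E" by (auto simp: E1_def)
    show "inj_on \<psi> E1"
    proof (rule inj_onI)
      fix e f assume ef: "e \<in> E1" "f \<in> E1" "\<psi> e = \<psi> f"
      then have "b e = b f"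
        using \<phi>(1)[OF beV[OF ef(1)] beV[OF ef(2)]] \<psi>_nbh(1)[OF ef(1)] \<psi>_nbh(1)[OF ef(2)] by auto
      then show "e = f" using \<psi>0(1)[of "b e"] ef by (auto simp: \<psi>_def dest: inj_onD)
    qed
    have "\<psi> e \<noteq> \<phi>' v" if "e \<in> E1" "v \<in> V" for e v
    proof (cases "v \<in> A'")
      case True
      then show ?thesis using hF F0Q \<psi>_nbh(3)[OF that(1)] by (auto simp: \<phi>'_def)
    next
      case False
      then show ?thesis
        using \<phi>(1)[OF beV[OF that(1)] that(2)] \<psi>_nbh[OF that(1)]
        by (cases "b e = v") (auto simp: nbh_def \<phi>'_def)
    qed
    then show "\<psi> ` E1 \<inter> \<phi>' ` V = {}" by auto
    have b_fix: "\<phi>' (b e) = \<phi> (b e)" if "e \<in> E" for e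
      using ba[OF that] A'(1) by (auto simp: \<phi>'_def)
    show "insert (\<psi> e) (\<phi>' ` e) \<in> H" if "e \<in> E1" for e
    proof -
      have e: "e \<in> E" "a e \<notin> A'" using that by (auto simp: E1_def)
      have "{\<phi> (b e), \<phi> (a e), \<psi> e} \<in> H" using \<psi>N[OF that] token_sub(4) by (auto simp: N_def)
      moreover have "\<phi>' ` {b e, a e} = {\<phi>' (b e), \<phi>' (a e)}" by blast
      moreover have "\<phi>' (a e) = \<phi> (a e)" using e(2) by (simp add: \<phi>'_def)
      ultimately have "insert (\<psi> e) (\<phi>' ` {b e, a e}) \<in> H"
        using b_fix[OF e(1)] by (simp only: insert_commute)
      then show ?thesis using ba[OF e(1)] by metis
    qed
    show "2 * card V \<le> card {z. insert z (\<phi>' ` e) \<in> H}" if "e \<in> E - E1" for e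
    proof -
      have e: "e \<in> E" "a e \<in> A'" using that by (auto simp: E1_def)
      have "fat (\<phi> (b e)) (h (a e))" using inR[OF e(1)] hF[OF e(2)] by (auto simp: R_def)
      then have "fat (\<phi>' (b e)) (\<phi>' (a e))" using b_fix[OF e(1)] e(2) by (simp add: \<phi>'_def)
      then have "2 * card V \<le> card {z. insert z (\<phi>' ` {b e, a e}) \<in> H}"
        unfolding link_image by (simp add: fat_def)
      then show ?thesis using ba[OF e(1)] by metis
    qed
  qed (use finV finE cardV in auto)
  then show False using free by simp
qed

end

section \<open>Counting edges\<close>

lemma card_fibres_le:
  assumes "finite T" and "finite B" and "f ` T \<subseteq> B" and "\<And>b. b \<in> B \<Longrightarrow> card {t\<in>T. f t = b} \<le> k"
  shows "card T \<le> k * card B"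
proof -
  have "card T = (\<Sum>b\<in>B. card {t\<in>T. f t = b})"
    using sum.group[OF assms(1,2,3), of "\<lambda>_. 1::nat"] by simp
  also have "\<dots> \<le> card B * k" using assms(4) by (intro sum_bounded_above[THEN order_trans]) auto
  finally show ?thesis by (simp add: mult.commute)
qed

lemma card_fibres_ge:
  assumes "finite T" and "finite B" and "\<And>b. b \<in> B \<Longrightarrow> k \<le> card {t\<in>T. f t = b}"
  shows "k * card B \<le> card T"
proof -
  define T' where "T' = {t\<in>T. f t \<in> B}"
  have T': "finite T'" "f ` T' \<subseteq> B" using assms(1) by (auto simp: T'_def)
  have "k * card B \<le> (\<Sum>b\<in>B. card {t\<in>T'. f t = b})"
  proof -
    have "{t\<in>T'. f t = b} = {t\<in>T. f t = b}" if "b \<in> B" for b using that by (auto simp: T'_def)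
    then have "of_nat (card B) * k \<le> (\<Sum>b\<in>B. card {t\<in>T'. f t = b})"
      using assms(3) by (intro sum_bounded_below) auto
    then show ?thesis by (simp add: mult.commute)
  qed
  also have "\<dots> = card T'" using sum.group[OF T'(1) assms(2) T'(2), of "\<lambda>_. 1::nat"] by simp
  also have "\<dots> \<le> card T" using assms(1) by (intro card_mono) (auto simp: T'_def)
  finally show ?thesis .
qed

context expansion_free
begin

section \<open>Classes of vertices and pairs\<close>

definition deg :: "nat \<Rightarrow> nat" where
  "deg v = card {u. fat v u}"

definition hubs :: "real \<Rightarrow> nat set" where
  "hubs \<eta> = {v. v < n \<and> \<eta> * n \<le> deg v}"

text \<open>This is disjoint from \<open>hubs \<eta>\<close> once \<open>M < \<eta> * n\<close>;
  vertices of intermediate fat degree belong to neither.\<close>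

definition low :: "nat \<Rightarrow> nat set" where
  "low M = {v. v < n \<and> deg v \<le> M}"

definition common :: "real \<Rightarrow> nat \<Rightarrow> nat \<Rightarrow> nat set" where
  "common \<eta> x y = {w\<in>hubs \<eta>. fat x w \<and> fat y w \<and> {x, y, w} \<in> H}"

definition light_pairs :: "nat \<Rightarrow> (nat \<times> nat) set" where
  "light_pairs M = {(x, y). x \<in> low M \<and> y \<in> low M \<and> x \<noteq> y \<and> \<not> fat x y}"

text \<open>Tokens of both ends count fully here, whereas the charge of a pair halves them.\<close>

definition bad :: "real \<Rightarrow> nat \<Rightarrow> (nat \<times> nat) set" where
  "bad \<eta> M = {(x, y). (x, y) \<in> light_pairs M \<and> card A \<le>
     card (token (low M) x y) + card (token (low M) y x) + card (common \<eta> x y)}"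

text \<open>The equality case of the charge bound: not being bad then forces both ends to own no
  token.\<close>

definition good :: "real \<Rightarrow> nat \<Rightarrow> (nat \<times> nat) set" where
  "good \<eta> M = {(x, y). (x, y) \<in> light_pairs M - bad \<eta> M \<and> card (common \<eta> x y) = card A - 1}"

text \<open>Pairs are ordered and only tokens of the first vertex count. So an edge with a hub is
  met at both orders of its light pair, and an edge with one fat pair once at each of its two light
  pairs: two pointed pairs per edge either way.\<close>

definition pointed :: "real \<Rightarrow> nat \<Rightarrow> ((nat \<times> nat) \<times> nat) set" where
  "pointed \<eta> M = Sigma (light_pairs M)
     (\<lambda>p. token (low M) (fst p) (snd p) \<union> common \<eta> (fst p) (snd p))"

lemma fin_nbrs: "finite {u. fat v u}"
proof (rule finite_subset)
  show "{u. fat v u} \<subseteq> {..<n}" using fat_vertices(3) by blast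
qed simp

lemma hubs_sub: "hubs \<eta> \<subseteq> {..<n}" and low_sub: "low M \<subseteq> {..<n}"
  by (auto simp: hubs_def low_def)

lemma fin_hubs: "finite (hubs \<eta>)" and fin_low: "finite (low M)"
  by (rule finite_subset[OF hubs_sub], simp) (rule finite_subset[OF low_sub], simp)

lemma hubs_low: "real M < (\<eta>::real) * n \<Longrightarrow> hubs \<eta> \<inter> low M = {}"
  by (auto simp: hubs_def low_def)

lemma low_deg: "x \<in> low M \<Longrightarrow> card {b\<in>low M. fat x b} \<le> M"
proof -
  assume x: "x \<in> low M"
  have "card {b\<in>low M. fat x b} \<le> deg x"
    unfolding deg_def using fin_nbrs by (intro card_mono) auto
  then show ?thesis using x by (simp add: low_def)
qed

lemma fin_token: "finite (token (low M) x y)"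
  using fin_low by (simp add: token_def)

lemma fin_common: "finite (common \<eta> x y)"
  using fin_hubs by (simp add: common_def)

lemma common_sym: "common \<eta> x y = common \<eta> y x"
  by (auto simp: common_def insert_commute)

lemma light_pairs_sub: "light_pairs M \<subseteq> low M \<times> low M"
  by (auto simp: light_pairs_def)

lemma light_pairs_sym: "(x, y) \<in> light_pairs M \<longleftrightarrow> (y, x) \<in> light_pairs M"
  using fat_sym by (auto simp: light_pairs_def)

lemma fin_light_pairs: "finite (light_pairs M)"
  using light_pairs_sub fin_low finite_subset by blast

lemma card_light_pairs: "card (light_pairs M) \<le> n\<^sup>2"
proof -
  have "light_pairs M \<subseteq> {..<n} \<times> {..<n}" using light_pairs_sub low_sub by blast
  then have "card (light_pairs M) \<le> card ({..<n} \<times> {..<n})" by (intro card_mono) auto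
  then show ?thesis by (simp add: power2_eq_square)
qed

lemma fin_pointed: "finite (pointed \<eta> M)"
  unfolding pointed_def using fin_light_pairs fin_token fin_common by auto

section \<open>Consequences of the linear number of fat pairs\<close>

lemma sum_deg: "(\<Sum>v<n. deg v) \<le> 2 * card V * n"
proof -
  have "{(x, y). fat x y} = (SIGMA x:{..<n}. {u. fat x u})" using fat_vertices by auto
  then have "card {(x, y). fat x y} = (\<Sum>v<n. deg v)"
    using fin_nbrs by (simp add: deg_def)
  then show ?thesis using card_fat by simp
qed

text \<open>Markov's inequality for the fat degrees. The bound does not depend on \<open>n\<close>,
  so sums over sets of hubs cost only a constant factor.\<close>

lemma card_hubs:
  fixes \<eta> :: real
  assumes "\<eta> > 0" and "n > 0"
  shows "card (hubs \<eta>) \<le> 2 * card V / \<eta>"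
proof -
  have "card (hubs \<eta>) * (\<eta> * n) \<le> (\<Sum>v\<in>hubs \<eta>. real (deg v))"
    by (intro sum_bounded_below) (auto simp: hubs_def)
  also have "\<dots> \<le> (\<Sum>v<n. real (deg v))" using hubs_sub by (intro sum_mono2) auto
  also have "\<dots> = real (\<Sum>v<n. deg v)" by simp
  also have "\<dots> \<le> real (2 * card V * n)" using sum_deg by (rule of_nat_mono)
  finally show ?thesis using assms by (simp add: field_simps)
qed

lemma card_high: "M * card ({..<n} - low M) \<le> 2 * card V * n"
proof -
  have "of_nat (card ({..<n} - low M)) * M \<le> (\<Sum>v\<in>{..<n} - low M. deg v)"
    by (intro sum_bounded_below) (auto simp: low_def)
  also have "\<dots> \<le> (\<Sum>v<n. deg v)" by (intro sum_mono2) auto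
  finally show ?thesis using sum_deg by (simp add: mult.commute)
qed

text \<open>Each of these edges contains a light pair starting outside \<open>low M\<close>, and a
  light pair lies in fewer than \<open>2 * card V\<close> edges.\<close>

lemma card_high_edges:
  "card {e\<in>H. \<exists>x\<in>e. \<exists>y\<in>e. x \<noteq> y \<and> \<not> fat x y \<and> x \<notin> low M} \<le>
     card ({..<n} - low M) * n * (2 * card V)"
proof -
  define S where "S = {(x, y). x \<in> {..<n} - low M \<and> y < n \<and> \<not> fat x y}"
  have Ssub: "S \<subseteq> ({..<n} - low M) \<times> {..<n}" by (auto simp: S_def)
  then have finS: "finite S" using finite_subset by blast
  have "{e\<in>H. \<exists>x\<in>e. \<exists>y\<in>e. x \<noteq> y \<and> \<not> fat x y \<and> x \<notin> low M} \<subseteq>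
      (\<Union>p\<in>S. (\<lambda>z. {fst p, snd p, z}) ` link (fst p) (snd p))"
  proof
    fix e assume "e \<in> {e\<in>H. \<exists>x\<in>e. \<exists>y\<in>e. x \<noteq> y \<and> \<not> fat x y \<and> x \<notin> low M}"
    then obtain x y where e: "e \<in> H" "x \<in> e" "y \<in> e" "x \<noteq> y" "\<not> fat x y" "x \<notin> low M" by auto
    then obtain z where z: "e = {x, y, z}" using third_vertex by metis
    have "(x, y) \<in> S" using e edge_bound[OF e(1)] by (auto simp: S_def)
    moreover have "e \<in> (\<lambda>z. {x, y, z}) ` link x y" using z e(1) by (auto simp: link_def)
    ultimately show "e \<in> (\<Union>p\<in>S. (\<lambda>z. {fst p, snd p, z}) ` link (fst p) (snd p))"
      by (intro UN_I[of "(x, y)"]) simp_all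
  qed
  then have "card {e\<in>H. \<exists>x\<in>e. \<exists>y\<in>e. x \<noteq> y \<and> \<not> fat x y \<and> x \<notin> low M} \<le>
      card (\<Union>p\<in>S. (\<lambda>z. {fst p, snd p, z}) ` link (fst p) (snd p))"
    using finS fin_link by (intro card_mono) auto
  also have "\<dots> \<le> (\<Sum>p\<in>S. card ((\<lambda>z. {fst p, snd p, z}) ` link (fst p) (snd p)))"
    using finS by (rule card_UN_le)
  also have "\<dots> \<le> of_nat (card S) * (2 * card V)"
  proof (intro sum_bounded_above)
    fix p assume "p \<in> S"
    then have "card (link (fst p) (snd p)) \<le> 2 * card V" by (auto simp: S_def fat_def)
    then show "card ((\<lambda>z. {fst p, snd p, z}) ` link (fst p) (snd p)) \<le> 2 * card V"
      using card_image_le[OF fin_link] le_trans by blast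
  qed
  also have "\<dots> \<le> card ({..<n} - low M) * n * (2 * card V)"
    using card_mono[OF _ Ssub] by (simp add: card_cartesian_product)
  finally show ?thesis .
qed

text \<open>A vertex \<open>v\<close> is the centre of at most \<open>deg v * deg v\<close> pairs of
  fat neighbours. Outside the hubs one factor is below \<open>\<eta> * n\<close>, and the other sums
  to at most \<open>2 * card V * n\<close>.\<close>

lemma card_cherry_edges:
  fixes \<eta> :: real
  assumes "\<eta> > 0"
  shows "card {e\<in>H. \<exists>v x y. e = {v, x, y} \<and> fat v x \<and> fat v y \<and> v \<notin> hubs \<eta>} \<le>
     2 * card V * \<eta> * real n ^ 2"
proof -
  define D where "D = {..<n} - hubs \<eta>"
  have "{e\<in>H. \<exists>v x y. e = {v, x, y} \<and> fat v x \<and> fat v y \<and> v \<notin> hubs \<eta>} \<subseteq>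
      (\<Union>v\<in>D. (\<lambda>(x, y). {v, x, y}) ` ({u. fat v u} \<times> {u. fat v u}))"
    using fat_vertices(2) by (auto simp: D_def)
  then have "card {e\<in>H. \<exists>v x y. e = {v, x, y} \<and> fat v x \<and> fat v y \<and> v \<notin> hubs \<eta>} \<le>
      card (\<Union>v\<in>D. (\<lambda>(x, y). {v, x, y}) ` ({u. fat v u} \<times> {u. fat v u}))"
    using fin_nbrs by (intro card_mono) (auto simp: D_def)
  also have "\<dots> \<le> (\<Sum>v\<in>D. card ((\<lambda>(x, y). {v, x, y}) ` ({u. fat v u} \<times> {u. fat v u})))"
    by (intro card_UN_le) (simp add: D_def)
  also have "\<dots> \<le> (\<Sum>v\<in>D. deg v * deg v)"
    using fin_nbrs by (intro sum_mono card_image_le[THEN order_trans])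
      (auto simp: deg_def card_cartesian_product)
  finally have "real (card {e\<in>H. \<exists>v x y. e = {v, x, y} \<and> fat v x \<and> fat v y \<and> v \<notin> hubs \<eta>}) \<le>
      real (\<Sum>v\<in>D. deg v * deg v)" by (rule of_nat_mono)
  also have "\<dots> = (\<Sum>v\<in>D. real (deg v) * real (deg v))" by simp
  also have "\<dots> \<le> (\<Sum>v\<in>D. (\<eta> * n) * real (deg v))"
    by (intro sum_mono mult_right_mono) (auto simp: D_def hubs_def)
  also have "\<dots> \<le> (\<Sum>v<n. (\<eta> * n) * real (deg v))"
    using assms by (intro sum_mono2) (auto simp: D_def)
  also have "\<dots> = (\<eta> * n) * real (\<Sum>v<n. deg v)" by (simp add: sum_distrib_left)
  also have "\<dots> \<le> (\<eta> * n) * real (2 * card V * n)"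
    using sum_deg assms by (intro mult_left_mono of_nat_mono) auto
  finally show ?thesis by (simp add: power2_eq_square mult_ac)
qed

lemma card_hub_edges: "card {e\<in>H. e \<subseteq> hubs \<eta>} \<le> 2 ^ card (hubs \<eta>)"
proof -
  have "card {e\<in>H. e \<subseteq> hubs \<eta>} \<le> card (Pow (hubs \<eta>))"
    using fin_hubs by (intro card_mono) auto
  then show ?thesis using fin_hubs by (simp add: card_Pow)
qed

section \<open>Double counting with pointed light pairs\<close>

lemma two_pointed:
  assumes "(x, y) \<in> light_pairs M" and "(x', y') \<in> light_pairs M" and "(x, y, z) \<noteq> (x', y', z')"
    and "z \<in> token (low M) x y \<union> common \<eta> x y" and "z' \<in> token (low M) x' y' \<union> common \<eta> x' y'"
    and "e = {x, y, z}" and "e = {x', y', z'}"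
  shows "2 \<le> card {t\<in>pointed \<eta> M. (\<lambda>((x, y), z). {x, y, z}) t = e}"
proof -
  have "{((x, y), z), ((x', y'), z')} \<subseteq> {t\<in>pointed \<eta> M. (\<lambda>((x, y), z). {x, y, z}) t = e}"
    using assms by (auto simp: pointed_def)
  then have "card {((x, y), z), ((x', y'), z')} \<le>
      card {t\<in>pointed \<eta> M. (\<lambda>((x, y), z). {x, y, z}) t = e}"
    using fin_pointed by (intro card_mono) auto
  moreover have "card {((x, y), z), ((x', y'), z')} = 2" using assms(3) by auto
  ultimately show ?thesis by simp
qed

text \<open>The edges that are not counted by pointed light pairs: those without fat pair, those with a
  light pair at a vertex of high fat degree, those with two fat pairs at a vertex which is no hub,
  and those inside the hubs.\<close>

lemma edges_le_pointed:
  fixes \<eta> :: real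
  assumes "\<eta> > 0"
  shows "2 * real (card H) \<le> card (pointed \<eta> M) + 2 * (4 * real (card V) ^ 2 * n +
    card ({..<n} - low M) * n * (2 * card V) + 2 * card V * \<eta> * real n ^ 2 + 2 ^ card (hubs \<eta>))"
proof -
  define E0 where "E0 = {e\<in>H. \<forall>x\<in>e. \<forall>y\<in>e. \<not> fat x y}"
  define E1 where "E1 = {e\<in>H. \<exists>x\<in>e. \<exists>y\<in>e. x \<noteq> y \<and> \<not> fat x y \<and> x \<notin> low M}"
  define E2 where "E2 = {e\<in>H. \<exists>v x y. e = {v, x, y} \<and> fat v x \<and> fat v y \<and> v \<notin> hubs \<eta>}"
  define E3 where "E3 = {e\<in>H. e \<subseteq> hubs \<eta>}"
  define H' where "H' = H - (E0 \<union> E1 \<union> E2 \<union> E3)"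
  have "2 \<le> card {t\<in>pointed \<eta> M. (\<lambda>((x, y), z). {x, y, z}) t = e}" if "e \<in> H'" for e
  proof -
    have e: "e \<in> H" "e \<notin> E0" "e \<notin> E1" "e \<notin> E2" "e \<notin> E3" using that by (auto simp: H'_def)
    from e(1,2) obtain a b where ab: "a \<in> e" "b \<in> e" "fat a b" by (auto simp: E0_def)
    then have "a \<noteq> b" using fat_vertices by blast
    then obtain c where abc: "e = {a, b, c}" using third_vertex e(1) ab by metis
    have dist: "a \<noteq> b" "a \<noteq> c" "b \<noteq> c" using edge_vertices abc e(1) by auto
    have lowI: "x \<in> low M" if "x \<in> e" "y \<in> e" "x \<noteq> y" "\<not> fat x y" for x y
      using e(1,3) that by (auto simp: E1_def)
    have hubI: "v \<in> hubs \<eta>" if "e = {v, x, y}" "fat v x" "fat v y" for v x y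
      using e(1,4) that by (auto simp: E2_def)
    have fs: "fat b a" using ab(3) fat_sym by blast
    consider "fat a c" "fat b c" | "fat a c" "\<not> fat b c" | "\<not> fat a c" "fat b c"
      | "\<not> fat a c" "\<not> fat b c" by blast
    then show ?thesis
    proof cases
      case 1
      \<comment> \<open>All three pairs are fat, so each vertex is the centre of two fat pairs and
        hence a hub.\<close>
      have "a \<in> hubs \<eta>" using hubI[of a b c] abc ab 1 by blast
      moreover have "b \<in> hubs \<eta>" using hubI[of b a c] abc fs 1 by (auto simp: insert_commute)
      moreover have "c \<in> hubs \<eta>" using hubI[of c a b] abc 1 fat_sym by (auto simp: insert_commute)
      ultimately have "e \<in> E3" using abc e(1) by (auto simp: E3_def)
      then show ?thesis using e by blast
    next
      case 2
      \<comment> \<open>The two fat pairs meet in \<open>a\<close>; the light pair \<open>bc\<close>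
        is counted in both orders with the hub \<open>a\<close>.\<close>
      have "a \<in> hubs \<eta>" using hubI[of a b c] abc ab 2 by blast
      moreover have "b \<in> low M" using lowI[of b c] abc dist 2 by auto
      moreover have "c \<in> low M" using lowI[of c b] abc dist 2 fat_sym by auto
      moreover have "fat c a" using 2 fat_sym by blast
      ultimately show ?thesis using abc e(1) fs 2 dist fat_sym
        by (intro two_pointed[of b c M c b a a])
          (auto simp: common_def light_pairs_def insert_commute)
    next
      case 3
      have "b \<in> hubs \<eta>" using hubI[of b a c] abc fs 3 by (auto simp: insert_commute)
      moreover have "a \<in> low M" using lowI[of a c] abc dist 3 by auto
      moreover have "c \<in> low M" using lowI[of c a] abc dist 3 fat_sym by auto
      moreover have "fat c b" using 3 fat_sym by blast
      ultimately show ?thesis using abc e(1) ab 3 dist fat_sym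
        by (intro two_pointed[of a c M c a b b])
          (auto simp: common_def light_pairs_def insert_commute)
    next
      case 4
      \<comment> \<open>Only \<open>ab\<close> is fat: \<open>b\<close> is a token of
        \<open>a\<close> at \<open>(a, c)\<close>, and \<open>a\<close> is a token of
        \<open>b\<close> at \<open>(b, c)\<close>.\<close>
      have "a \<in> low M" using lowI[of a c] abc dist 4 by auto
      moreover have "b \<in> low M" using lowI[of b c] abc dist 4 by auto
      moreover have "c \<in> low M" using lowI[of c a] abc dist 4 fat_sym by auto
      ultimately show ?thesis using abc e(1) ab fs 4 dist
        by (intro two_pointed[of a c M b c b a])
          (auto simp: token_def light_pairs_def insert_commute)
    qed
  qed
  then have H'_le: "2 * card H' \<le> card (pointed \<eta> M)"
    using fin_pointed finH by (intro card_fibres_ge[where f = "\<lambda>((x, y), z). {x, y, z}"])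
      (auto simp: H'_def)
  have H_le: "card H \<le> card H' + (card E0 + card E1 + card E2 + card E3)"
  proof -
    have "H \<subseteq> H' \<union> (E0 \<union> E1 \<union> E2 \<union> E3)" by (auto simp: H'_def)
    moreover have "finite (H' \<union> (E0 \<union> E1 \<union> E2 \<union> E3))"
      using finH by (auto simp: H'_def E0_def E1_def E2_def E3_def)
    ultimately have "card H \<le> card (H' \<union> (E0 \<union> E1 \<union> E2 \<union> E3))" by (intro card_mono)
    also have "\<dots> \<le> card H' + card (E0 \<union> E1 \<union> E2 \<union> E3)" by (rule card_Un_le)
    also have "card (E0 \<union> E1 \<union> E2 \<union> E3) \<le> card (E0 \<union> E1 \<union> E2) + card E3" by (rule card_Un_le)
    also have "card (E0 \<union> E1 \<union> E2) \<le> card (E0 \<union> E1) + card E2" by (rule card_Un_le)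
    also have "card (E0 \<union> E1) \<le> card E0 + card E1" by (rule card_Un_le)
    finally show ?thesis by simp
  qed
  have "2 * card H \<le> 2 * card H' + 2 * (card E0 + card E1 + card E2 + card E3)"
    using H_le by simp
  then have "2 * card H \<le> card (pointed \<eta> M) + 2 * (card E0 + card E1 + card E2 + card E3)"
    using H'_le by (meson add_right_mono le_trans)
  from of_nat_mono[OF this, where 'a = real]
  have "2 * real (card H) \<le> card (pointed \<eta> M) +
      2 * (real (card E0) + card E1 + card E2 + card E3)"
    by simp
  also have "\<dots> \<le> card (pointed \<eta> M) + 2 * (4 * real (card V) ^ 2 * n +
    card ({..<n} - low M) * n * (2 * card V) + 2 * card V * \<eta> * real n ^ 2 + 2 ^ card (hubs \<eta>))"
  proof (intro add_left_mono mult_left_mono add_mono)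
    show "real (card E0) \<le> 4 * real (card V) ^ 2 * n"
      using of_nat_mono[OF card_light_edges, where 'a = real] by (simp add: E0_def)
    show "real (card E1) \<le> card ({..<n} - low M) * n * (2 * card V)"
      unfolding E1_def by (intro of_nat_mono card_high_edges)
    show "real (card E2) \<le> 2 * card V * \<eta> * real n ^ 2"
      unfolding E2_def using card_cherry_edges[OF assms] .
    show "real (card E3) \<le> 2 ^ card (hubs \<eta>)"
      using of_nat_mono[OF card_hub_edges, where 'a = real] by (simp add: E3_def)
  qed simp
  finally show ?thesis .
qed

text \<open>Either both ends own tokens, which \<open>card_two_sided\<close> bounds, or one end owns
  none and the other satisfies the condition of \<open>card_one_sided\<close> for some set of common
  hubs. The power of 2 bounds the number of such sets; the factor before it accounts for the order
  of the pair.\<close>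

lemma card_bad:
  fixes \<eta> :: real
  assumes "real M < \<eta> * n"
  shows "card (bad \<eta> M) \<le>
    (1 + 2 * 2 ^ card (hubs \<eta>)) * (2 * (card V * (M + 1)\<^sup>2) * n)"
proof -
  define Q where "Q = low M"
  define K where "K = 2 * (card V * (M + 1)\<^sup>2) * n"
  define two where "two = {(x, y). x \<in> Q \<and> y \<in> Q \<and> token Q x y \<noteq> {} \<and> token Q y x \<noteq> {}}"
  define one where "one = (\<lambda>F0. {(x, y). x \<in> Q \<and> y \<in> Q \<and> (\<forall>w\<in>F0. fat x w \<and> fat y w) \<and>
      card A \<le> card F0 + card (token Q x y)})"
  define \<F> where "\<F> = {F0. F0 \<subseteq> hubs \<eta> \<and> card F0 \<le> card A}"
  have Fsub: "\<F> \<subseteq> Pow (hubs \<eta>)" by (auto simp: \<F>_def)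
  have finF: "finite \<F>" using Fsub fin_hubs finite_subset by blast
  have cF: "card \<F> \<le> 2 ^ card (hubs \<eta>)" using card_mono[OF _ Fsub] fin_hubs by (simp add: card_Pow)
  have c2: "card two \<le> K" unfolding two_def K_def Q_def using low_sub low_deg by (rule card_two_sided)
  have c1: "card (one F0) \<le> K" if "F0 \<in> \<F>" for F0
    unfolding one_def K_def Q_def
  proof (rule card_one_sided[OF low_sub low_deg])
    show "finite F0" using that fin_hubs finite_subset by (auto simp: \<F>_def)
    show "F0 \<inter> low M = {}" using that hubs_low[OF assms] by (auto simp: \<F>_def)
    show "card F0 \<le> card A" using that by (auto simp: \<F>_def)
  qed
  have in_one: "\<exists>F0\<in>\<F>. (x, y) \<in> one F0"
    if xy: "x \<in> Q" "y \<in> Q" and le: "card A \<le> card (token Q x y) + card (common \<eta> x y)" for x y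
  proof -
    \<comment> \<open>Since \<open>card_one_sided\<close> needs \<open>card F0 \<le> card A\<close>,
      surplus common hubs are dropped.\<close>
    have "\<exists>F0\<subseteq>common \<eta> x y. card F0 = min (card A) (card (common \<eta> x y))"
      using obtain_subset_with_card_n[of "min (card A) (card (common \<eta> x y))" "common \<eta> x y"]
      by (metis min.cobounded2)
    then obtain F0 where F0: "F0 \<subseteq> common \<eta> x y" "card F0 = min (card A) (card (common \<eta> x y))"
      by blast
    then have "F0 \<in> \<F>" by (auto simp: \<F>_def common_def)
    moreover have "card A \<le> card F0 + card (token Q x y)" using F0(2) le by linarith
    ultimately show ?thesis using F0(1) xy by (intro bexI[of _ F0]) (auto simp: one_def common_def)
  qed
  have "bad \<eta> M \<subseteq> two \<union> ((\<Union>F0\<in>\<F>. one F0) \<union> (\<Union>F0\<in>\<F>. prod.swap ` one F0))"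
  proof
    fix p assume "p \<in> bad \<eta> M"
    then obtain x y where p: "p = (x, y)" "x \<in> Q" "y \<in> Q"
      and le: "card A \<le> card (token Q x y) + card (token Q y x) + card (common \<eta> x y)"
      by (auto simp: bad_def light_pairs_def Q_def)
    consider "token Q y x = {}" | "token Q x y = {}" | "token Q y x \<noteq> {}" "token Q x y \<noteq> {}" by blast
    then show "p \<in> two \<union> ((\<Union>F0\<in>\<F>. one F0) \<union> (\<Union>F0\<in>\<F>. prod.swap ` one F0))"
    proof cases
      case 1
      then show ?thesis using in_one[OF p(2,3)] le p(1) by auto
    next
      case 2
      then obtain F0 where "F0 \<in> \<F>" "(y, x) \<in> one F0"
        using in_one[OF p(3,2)] le common_sym[of \<eta> x y] by auto
      then show ?thesis using p(1) by (auto intro!: image_eqI[of _ prod.swap "(y, x)"])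
    next
      case 3
      then show ?thesis using p by (auto simp: two_def)
    qed
  qed
  moreover have finone: "finite (one F0)" and "finite two" for F0
    using fin_low by (auto simp: one_def two_def Q_def intro: finite_subset[of _ "low M \<times> low M"])
  ultimately have "card (bad \<eta> M) \<le>
      card (two \<union> ((\<Union>F0\<in>\<F>. one F0) \<union> (\<Union>F0\<in>\<F>. prod.swap ` one F0)))"
    using finF by (intro card_mono) auto
  also have "\<dots> \<le> card two + card ((\<Union>F0\<in>\<F>. one F0) \<union> (\<Union>F0\<in>\<F>. prod.swap ` one F0))"
    by (rule card_Un_le)
  also have "\<dots> \<le> card two + (card (\<Union>F0\<in>\<F>. one F0) + card (\<Union>F0\<in>\<F>. prod.swap ` one F0))"
    by (intro add_left_mono card_Un_le)
  also have "card (\<Union>F0\<in>\<F>. one F0) \<le> card \<F> * K"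
    using c1 by (intro card_UN_le[OF finF, THEN order_trans] sum_bounded_above[THEN order_trans]) auto
  also have "card (\<Union>F0\<in>\<F>. prod.swap ` one F0) \<le> card \<F> * K"
    using c1 finone
    by (intro card_UN_le[OF finF, THEN order_trans] sum_bounded_above[THEN order_trans])
      (auto intro: card_image_le[THEN order_trans])
  also have "card \<F> * K \<le> 2 ^ card (hubs \<eta>) * K" using cF by (rule mult_right_mono) simp
  finally show ?thesis using c2 by (simp add: K_def algebra_simps)
qed

text \<open>Adding both orders of a pair gives it the weight
  \<open>t p + t (prod.swap p) + 2 * h p\<close>. Unless bad, it weighs at most
  \<open>2 * (card A - 1)\<close>, and at least one less unless it is good. For
  \<open>card A = 1\<close> the coefficient of \<open>card (light_pairs M)\<close> is negative, so
  this case gets its own bound.\<close>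

lemma pointed_le:
  assumes "card A \<ge> 1"
  shows "2 * real (card (pointed \<eta> M)) \<le>
      (2 * (real (card A) - 1) - 1) * card (light_pairs M) + card (good \<eta> M) +
      (8 * real (card V) + 1) * real (card (bad \<eta> M))"
    and "card A = 1 \<Longrightarrow> card (pointed \<eta> M) \<le> 4 * card V * card (bad \<eta> M)"
proof -
  define t where "t = (\<lambda>p. card (token (low M) (fst p) (snd p)))"
  define h where "h = (\<lambda>p. card (common \<eta> (fst p) (snd p)))"
  define L where "L = light_pairs M"
  have finL: "finite L" using fin_light_pairs by (simp add: L_def)
  have card_t: "t p \<le> 2 * card V" and card_h: "h p \<le> 2 * card V" if "p \<in> L" for p
  proof -
    have "card (link (fst p) (snd p)) \<le> 2 * card V"
      using that by (auto simp: L_def light_pairs_def fat_def)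
    moreover have "t p \<le> card (link (fst p) (snd p))" "h p \<le> card (link (fst p) (snd p))"
      unfolding t_def h_def using fin_link
      by (auto simp: token_def common_def link_def intro!: card_mono)
    ultimately show "t p \<le> 2 * card V" "h p \<le> 2 * card V" by auto
  qed
  have swapL: "prod.swap p \<in> L" if "p \<in> L" for p
    using that light_pairs_sym by (cases p) (auto simp: L_def)
  have "card (pointed \<eta> M) = (\<Sum>p\<in>L. card (token (low M) (fst p) (snd p) \<union> common \<eta> (fst p) (snd p)))"
    unfolding pointed_def L_def using fin_light_pairs fin_token fin_common by (intro card_SigmaI) auto
  also have "\<dots> \<le> (\<Sum>p\<in>L. t p + h p)"
    unfolding t_def h_def by (intro sum_mono card_Un_le)
  finally have P: "card (pointed \<eta> M) \<le> (\<Sum>p\<in>L. t p + h p)" .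
  have "(\<Sum>p\<in>L. t (prod.swap p)) = (\<Sum>p\<in>L. t p)"
    by (rule sum.reindex_bij_witness[where i = prod.swap and j = prod.swap]) (auto simp: swapL)
  then have swap_sum: "(\<Sum>p\<in>L. t p + t (prod.swap p) + 2 * h p) = 2 * (\<Sum>p\<in>L. t p + h p)"
    by (simp add: sum.distrib flip: sum_distrib_left)
  have bad_iff: "p \<in> bad \<eta> M \<longleftrightarrow> card A \<le> t p + t (prod.swap p) + h p" if "p \<in> L" for p
    using that by (cases p) (auto simp: bad_def L_def t_def h_def)
  have good_iff: "p \<in> good \<eta> M \<longleftrightarrow> p \<notin> bad \<eta> M \<and> h p = card A - 1" if "p \<in> L" for p
    using that by (cases p) (auto simp: good_def L_def h_def)
  have sub: "bad \<eta> M \<subseteq> L" "good \<eta> M \<subseteq> L" by (auto simp: bad_def good_def L_def)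
  have ind: "(\<Sum>p\<in>L. of_bool (p \<in> B)) = real (card B)" if "B \<subseteq> L" for B
    using that finL by (simp add: Int_absorb1 flip: Int_def)
  \<comment> \<open>The 1 added to \<open>8 * card V\<close> compensates the constant term, which is
    \<open>-1\<close> for \<open>card A = 1\<close>.\<close>
  have point: "real (t p + t (prod.swap p) + 2 * h p) \<le> (2 * (real (card A) - 1) - 1) +
      of_bool (p \<in> good \<eta> M) + (8 * real (card V) + 1) * of_bool (p \<in> bad \<eta> M)" if p: "p \<in> L" for p
  proof (cases "p \<in> bad \<eta> M")
    case True
    then have "t p + t (prod.swap p) + 2 * h p \<le> 8 * card V"
      using card_t[OF p] card_h[OF p] card_t[OF swapL[OF p]] by linarith
    then have "real (t p + t (prod.swap p) + 2 * h p) \<le> 8 * real (card V)" by linarith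
    then show ?thesis using True assms by simp
  next
    case False
    then have b: "t p + t (prod.swap p) + h p + 1 \<le> card A" using bad_iff[OF p] by simp
    show ?thesis
    proof (cases "h p = card A - 1")
      case True
      then have "p \<in> good \<eta> M" using good_iff[OF p] False by simp
      moreover have "t p + t (prod.swap p) + 2 * h p + 2 \<le> 2 * card A" using b True by linarith
      then have "real (t p + t (prod.swap p) + 2 * h p) + 2 \<le> 2 * real (card A)"
        by linarith
      ultimately show ?thesis using False by simp
    next
      case no: False
      \<comment> \<open>Here \<open>h p\<close> is at most \<open>card A - 2\<close>, while tokens
        and hubs together number at most \<open>card A - 1\<close>.\<close>
      then have "t p + t (prod.swap p) + 2 * h p + 3 \<le> 2 * card A" using b by linarith
      then have "real (t p + t (prod.swap p) + 2 * h p) + 3 \<le> 2 * real (card A)"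
        by linarith
      then show ?thesis using False by simp
    qed
  qed
  have "2 * real (card (pointed \<eta> M)) \<le> real (2 * (\<Sum>p\<in>L. t p + h p))" using P by linarith
  also have "\<dots> = (\<Sum>p\<in>L. real (t p + t (prod.swap p) + 2 * h p))"
    unfolding swap_sum[symmetric] by (rule of_nat_sum)
  also have "\<dots> \<le> (\<Sum>p\<in>L. (2 * (real (card A) - 1) - 1) +
      of_bool (p \<in> good \<eta> M) + (8 * real (card V) + 1) * of_bool (p \<in> bad \<eta> M))"
    by (intro sum_mono point)
  also have "\<dots> = (\<Sum>p\<in>L. 2 * (real (card A) - 1) - 1) + (\<Sum>p\<in>L. of_bool (p \<in> good \<eta> M)) +
      (8 * real (card V) + 1) * (\<Sum>p\<in>L. of_bool (p \<in> bad \<eta> M))"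
    unfolding sum.distrib sum_distrib_left by (rule refl)
  also have "\<dots> = (2 * (real (card A) - 1) - 1) * card L + card (good \<eta> M) +
      (8 * real (card V) + 1) * real (card (bad \<eta> M))"
    unfolding ind[OF sub(1)] ind[OF sub(2)] sum_constant by (simp only: mult.commute)
  finally show "2 * real (card (pointed \<eta> M)) \<le>
      (2 * (real (card A) - 1) - 1) * card (light_pairs M) + card (good \<eta> M) +
      (8 * real (card V) + 1) * real (card (bad \<eta> M))" by (simp add: L_def)
  show "card (pointed \<eta> M) \<le> 4 * card V * card (bad \<eta> M)" if "card A = 1"
  proof -
    have "(\<Sum>p\<in>L. t p + h p) \<le> (\<Sum>p\<in>L. if p \<in> bad \<eta> M then 4 * card V else 0)"
    proof (rule sum_mono)
      fix p assume "p \<in> L"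
      then show "t p + h p \<le> (if p \<in> bad \<eta> M then 4 * card V else 0)"
        using bad_iff[of p] card_t[of p] card_h[of p] that by auto
    qed
    also have "\<dots> = 4 * card V * card (bad \<eta> M)"
      using sub(1) finL by (simp add: sum.If_cases Int_absorb1)
    finally show ?thesis using P by linarith
  qed
qed

end

section \<open>Stability\<close>

context expansion_free
begin

section \<open>Hub neighbourhoods\<close>

definition hub_nbrs :: "real \<Rightarrow> nat \<Rightarrow> nat set" where
  "hub_nbrs \<eta> x = {w\<in>hubs \<eta>. fat x w}"

text \<open>Any two low vertices that are fat to all of a set \<open>S\<close> of
  \<open>card A\<close> hubs satisfy the condition of \<open>card_one_sided\<close> without tokens.
  The square of the number of such vertices is thus linear in \<open>n\<close>, and only boundedly
  many \<open>S\<close> occur.\<close>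

lemma card_exceptional:
  fixes \<eta> r :: real
  assumes "real M < \<eta> * n" and "r \<ge> 0" and "real (2 * (card V * (M + 1)\<^sup>2) * n) \<le> r\<^sup>2"
  shows "card {x\<in>low M. card A \<le> card (hub_nbrs \<eta> x)} \<le> 2 ^ card (hubs \<eta>) * r"
proof -
  define X where "X = (\<lambda>S. {x\<in>low M. \<forall>w\<in>S. fat x w})"
  define \<F> where "\<F> = {S. S \<subseteq> hubs \<eta> \<and> card S = card A}"
  have Fsub: "\<F> \<subseteq> Pow (hubs \<eta>)" by (auto simp: \<F>_def)
  have finF: "finite \<F>" using Fsub fin_hubs finite_subset by blast
  have cF: "card \<F> \<le> 2 ^ card (hubs \<eta>)" using card_mono[OF _ Fsub] fin_hubs by (simp add: card_Pow)
  have finX: "finite (X S)" for S using fin_low by (simp add: X_def)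
  have cX: "real (card (X S)) \<le> r" if "S \<in> \<F>" for S
  proof -
    define R where "R = {(x, y). x \<in> low M \<and> y \<in> low M \<and> (\<forall>w\<in>S. fat x w \<and> fat y w) \<and>
      card A \<le> card S + card (token (low M) x y)}"
    have "card R \<le> 2 * (card V * (M + 1)\<^sup>2) * n"
      unfolding R_def
    proof (rule card_one_sided[OF low_sub low_deg])
      show "finite S" using that fin_hubs finite_subset by (auto simp: \<F>_def)
      show "S \<inter> low M = {}" using that hubs_low[OF assms(1)] by (auto simp: \<F>_def)
      show "card S \<le> card A" using that by (auto simp: \<F>_def)
    qed
    moreover have "X S \<times> X S \<subseteq> R" using that by (auto simp: X_def R_def \<F>_def)
    moreover have "finite R"
      using fin_low by (intro finite_subset[of R "low M \<times> low M"]) (auto simp: R_def)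
    ultimately have "card (X S \<times> X S) \<le> 2 * (card V * (M + 1)\<^sup>2) * n"
      by (meson card_mono le_trans)
    then have "real (card (X S \<times> X S)) \<le> real (2 * (card V * (M + 1)\<^sup>2) * n)"
      by (rule of_nat_mono)
    then have "(real (card (X S)))\<^sup>2 \<le> r\<^sup>2"
      using assms(3) by (simp add: card_cartesian_product power2_eq_square)
    then show ?thesis using assms(2) by (rule power2_le_imp_le)
  qed
  have "{x\<in>low M. card A \<le> card (hub_nbrs \<eta> x)} \<subseteq> (\<Union>S\<in>\<F>. X S)"
  proof
    fix x assume "x \<in> {x\<in>low M. card A \<le> card (hub_nbrs \<eta> x)}"
    then have x: "x \<in> low M" "card A \<le> card (hub_nbrs \<eta> x)" by auto
    then obtain S where "S \<subseteq> hub_nbrs \<eta> x" "card S = card A"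
      using obtain_subset_with_card_n by metis
    then show "x \<in> (\<Union>S\<in>\<F>. X S)" using x(1) by (auto simp: \<F>_def X_def hub_nbrs_def)
  qed
  then have "card {x\<in>low M. card A \<le> card (hub_nbrs \<eta> x)} \<le> card (\<Union>S\<in>\<F>. X S)"
    using finF finX by (intro card_mono) auto
  also have "\<dots> \<le> (\<Sum>S\<in>\<F>. card (X S))" using finF by (rule card_UN_le)
  finally have "real (card {x\<in>low M. card A \<le> card (hub_nbrs \<eta> x)}) \<le> (\<Sum>S\<in>\<F>. real (card (X S)))"
    by (metis of_nat_le_iff of_nat_sum)
  also have "\<dots> \<le> real (card \<F>) * r" using cX by (rule sum_bounded_above)
  also have "\<dots> \<le> 2 ^ card (hubs \<eta>) * r"
    using assms(2) of_nat_mono[OF cF, where 'a = real] by (intro mult_right_mono) auto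
  finally show ?thesis .
qed

lemma common_sub: "common \<eta> x y \<subseteq> hub_nbrs \<eta> x" "common \<eta> x y \<subseteq> hub_nbrs \<eta> y"
  by (auto simp: common_def hub_nbrs_def)

lemma fin_hub_nbrs: "finite (hub_nbrs \<eta> x)"
  using fin_hubs by (simp add: hub_nbrs_def)

lemma good_sub: "good \<eta> M \<subseteq> low M \<times> low M"
  using light_pairs_sub by (auto simp: good_def)

text \<open>A vertex \<open>x\<close> in many good pairs and with only \<open>card A - 1\<close> fat hub neighbours dictates the
  fat hub neighbours of almost all other vertices.\<close>

lemma dominant_hubs:
  fixes \<eta> \<kappa> \<theta> :: real
  assumes "n > 0" and "\<kappa> \<ge> 0" and "\<theta> \<ge> 0" and "\<kappa> + \<theta> < 1" and "card A \<ge> 1"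
    and good: "(1 - \<kappa>) * real n ^ 2 \<le> card (good \<eta> M)"
    and exc: "card {x\<in>low M. card A \<le> card (hub_nbrs \<eta> x)} \<le> \<theta> * n"
  shows "\<exists>L\<subseteq>hubs \<eta>. card L = card A - 1 \<and>
    (1 - 3 * \<kappa> - 4 * \<theta>) * real n ^ 2 \<le> card {(x, y)\<in>good \<eta> M. \<forall>w\<in>L. {x, y, w} \<in> H}"
proof -
  define X where "X = {x\<in>low M. card A \<le> card (hub_nbrs \<eta> x)}"
  define G where "G = (\<lambda>x. {y. (x, y) \<in> good \<eta> M})"
  have finG: "finite (G x)" for x
    using good_sub fin_low by (intro finite_subset[of "G x" "low M"]) (auto simp: G_def)
  have fing: "finite (good \<eta> M)" using good_sub fin_low finite_subset by blast
  have finX: "finite X" and X_n: "X \<subseteq> {..<n}" using fin_low low_sub by (auto simp: X_def)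
  have G_n: "card (G x) \<le> n" for x
  proof -
    have "G x \<subseteq> {..<n}" using good_sub[of \<eta> M] low_sub[of M] by (auto simp: G_def)
    then show ?thesis using card_mono[of "{..<n}" "G x"] by simp
  qed
  \<comment> \<open>Averaging: the rows of \<open>X\<close> hold at most
    \<open>\<theta> * n^2\<close> good pairs, so some other row has size at least
    \<open>(1 - \<kappa> - \<theta>) * n\<close>.\<close>
  have "\<exists>x\<in>{..<n} - X. (1 - \<kappa> - \<theta>) * n \<le> card (G x)"
  proof (rule ccontr)
    assume "\<not> ?thesis"
    then have lt: "real (card (G x)) \<le> (1 - \<kappa> - \<theta>) * n" "real (card (G x)) < (1 - \<kappa> - \<theta>) * n"
      if "x \<in> {..<n} - X" for x using that by force+
    have eq: "good \<eta> M = (SIGMA x:{..<n}. G x)"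
      using good_sub[of \<eta> M] low_sub[of M] by (auto simp: G_def)
    have "real (card (good \<eta> M)) = (\<Sum>x<n. real (card (G x)))"
      unfolding eq using finG by simp
    also have "\<dots> = (\<Sum>x\<in>X. real (card (G x))) + (\<Sum>x\<in>{..<n} - X. real (card (G x)))"
      using X_n by (simp add: sum.subset_diff add.commute)
    finally have split: "real (card (good \<eta> M)) =
        (\<Sum>x\<in>X. real (card (G x))) + (\<Sum>x\<in>{..<n} - X. real (card (G x)))" .
    have b1: "(\<Sum>x\<in>X. real (card (G x))) \<le> \<theta> * real n ^ 2"
    proof -
      have "(\<Sum>x\<in>X. real (card (G x))) \<le> real (card X) * n"
        using G_n by (intro sum_bounded_above) simp
      also have "\<dots> \<le> \<theta> * n * n" using exc by (intro mult_right_mono) (auto simp: X_def)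
      finally show ?thesis by (simp add: power2_eq_square)
    qed
    show False
    proof (cases "{..<n} - X = {}")
      case True
      then have "real (card (good \<eta> M)) \<le> \<theta> * real n ^ 2"
        using split b1 unfolding True sum.empty by linarith
      then have "(1 - \<kappa>) * real n ^ 2 \<le> \<theta> * real n ^ 2" using good by linarith
      then have "1 - \<kappa> \<le> \<theta>" using assms(1) by simp
      then show False using assms(4) by linarith
    next
      case False
      have "(\<Sum>x\<in>{..<n} - X. real (card (G x))) < (\<Sum>x\<in>{..<n} - X. (1 - \<kappa> - \<theta>) * n)"
        using False lt(2) by (intro sum_strict_mono) auto
      also have "\<dots> = real (card ({..<n} - X)) * ((1 - \<kappa> - \<theta>) * n)" by simp
      also have "\<dots> \<le> real n * ((1 - \<kappa> - \<theta>) * n)"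
        using assms(4) card_mono[of "{..<n}" "{..<n} - X"] by (intro mult_right_mono) auto
      also have "\<dots> = (1 - \<kappa> - \<theta>) * real n ^ 2" by (simp add: power2_eq_square)
      finally have "real (card (good \<eta> M)) < \<theta> * real n ^ 2 + (1 - \<kappa> - \<theta>) * real n ^ 2"
        using split b1 by linarith
      also have "\<dots> = (1 - \<kappa>) * real n ^ 2" by (simp add: algebra_simps)
      finally show False using good by simp
    qed
  qed
  then obtain x where x: "x \<notin> X" "(1 - \<kappa> - \<theta>) * n \<le> card (G x)" by auto
  have "0 < (1 - \<kappa> - \<theta>) * n" using assms by simp
  then have "card (G x) > 0" using x(2) by linarith
  then obtain y0 where y0: "(x, y0) \<in> good \<eta> M"
    by (auto simp: G_def card_gt_0_iff)
  define L where "L = hub_nbrs \<eta> x"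
  have cL: "card L \<le> card A - 1"
    using x(1) y0 good_sub by (auto simp: X_def L_def)
  \<comment> \<open>The set \<open>common \<eta> x y\<close> lies in \<open>L\<close> and already
    has \<open>card A - 1\<close> elements, the most that \<open>L\<close> can have, so the two
    coincide.\<close>
  have goodL: "common \<eta> x y = L \<and> card L = card A - 1 \<and> L \<subseteq> hub_nbrs \<eta> y"
    if "(x, y) \<in> good \<eta> M" for y
  proof -
    have c: "card (common \<eta> x y) = card A - 1" using that by (auto simp: good_def)
    have "common \<eta> x y = L"
      using common_sub(1) fin_hub_nbrs cL c card_mono[of L "common \<eta> x y"]
      by (intro card_seteq) (auto simp: L_def)
    then show ?thesis using c common_sub(2) by metis
  qed
  have L_card: "card L = card A - 1" using goodL y0 by blast
  \<comment> \<open>Partners of \<open>x\<close> in good pairs have all of \<open>L\<close> among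
    their hub neighbours, and outside \<open>X\<close> there is no room for more; hence
    \<open>Y\<close> is almost everything.\<close>
  define Y where "Y = {y\<in>low M. hub_nbrs \<eta> y = L}"
  have finY: "finite Y" using fin_low by (simp add: Y_def)
  have Y_n: "card Y \<le> n"
  proof -
    have "Y \<subseteq> {..<n}" using low_sub by (auto simp: Y_def)
    then show ?thesis using card_mono[of "{..<n}" Y] by simp
  qed
  have "G x \<subseteq> Y \<union> X"
  proof
    fix y assume y: "y \<in> G x"
    then have lo: "y \<in> low M" using good_sub by (auto simp: G_def)
    show "y \<in> Y \<union> X"
    proof (cases "y \<in> X")
      case False
      then have "card (hub_nbrs \<eta> y) \<le> card L" using lo L_card by (auto simp: X_def)
      then have "L = hub_nbrs \<eta> y"
        using goodL[of y] y fin_hub_nbrs by (intro card_seteq) (auto simp: G_def)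
      then show ?thesis using lo by (simp add: Y_def)
    qed simp
  qed
  then have "card (G x) \<le> card (Y \<union> X)" using finY finX by (intro card_mono) auto
  also have "\<dots> \<le> card Y + card X" by (rule card_Un_le)
  finally have "real (card (G x)) \<le> real (card Y) + real (card X)" by linarith
  then have Y_ge: "(1 - \<kappa> - 2 * \<theta>) * n \<le> card Y"
    using x(2) exc by (simp add: X_def algebra_simps)
  define GY where "GY = {(x, y)\<in>good \<eta> M. \<forall>w\<in>L. {x, y, w} \<in> H}"
  have finGY: "finite GY" using fing by (rule rev_finite_subset) (auto simp: GY_def)
  have in_GY: "p \<in> GY" if p: "p \<in> good \<eta> M" "p \<in> Y \<times> Y" for p
  proof -
    obtain a b where ab: "p = (a, b)" by (cases p)
    have c: "card (common \<eta> a b) = card A - 1" using p ab by (auto simp: good_def)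
    have "common \<eta> a b = L"
      using common_sub(1)[of \<eta> a b] p ab fin_hub_nbrs[of \<eta> a] L_card c
      by (intro card_seteq) (auto simp: Y_def)
    then have "\<forall>w\<in>L. {a, b, w} \<in> H" by (auto simp: common_def)
    then show ?thesis using p ab by (simp add: GY_def)
  qed
  have "(1 - 3 * \<kappa> - 4 * \<theta>) * real n ^ 2 \<le> card GY"
  proof -
    have sub: "good \<eta> M \<subseteq> GY \<union> ({..<n} \<times> {..<n} - Y \<times> Y)"
      using in_GY good_sub low_sub by blast
    have YY: "Y \<times> Y \<subseteq> {..<n} \<times> {..<n}" using low_sub by (auto simp: Y_def)
    have "card (good \<eta> M) \<le> card (GY \<union> ({..<n} \<times> {..<n} - Y \<times> Y))"
      using finGY sub by (intro card_mono) auto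
    also have "\<dots> \<le> card GY + card ({..<n} \<times> {..<n} - Y \<times> Y)" by (rule card_Un_le)
    also have "card ({..<n} \<times> {..<n} - Y \<times> Y) = n * n - card Y * card Y"
      using YY finY by (simp add: card_Diff_subset card_cartesian_product)
    finally have "card (good \<eta> M) + card Y * card Y \<le> card GY + n * n"
      using mult_le_mono[OF Y_n Y_n] by linarith
    from of_nat_mono[OF this, where 'a = real]
    have 1: "card (good \<eta> M) + real (card Y) * card Y \<le> card GY + real n * n" by simp
    \<comment> \<open>This is \<open>(1 - a)^2 \<ge> 1 - 2 * a\<close> with
      \<open>a = \<kappa> + 2 * \<theta>\<close>; one \<theta> stems from the choice of
      \<open>x\<close>, the other from discarding \<open>X\<close>. The pairs that are not good add
      the third \<kappa>.\<close>
    have 2: "(1 - 2 * (\<kappa> + 2 * \<theta>)) * real n ^ 2 \<le> real (card Y) * card Y"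
    proof -
      define q where "q = real n - card Y"
      have q: "q \<le> (\<kappa> + 2 * \<theta>) * n" using Y_ge by (simp add: q_def algebra_simps)
      have "real (card Y) * card Y = real n ^ 2 - 2 * (q * n) + q * q"
        by (simp add: q_def power2_eq_square algebra_simps)
      moreover have "q * n \<le> (\<kappa> + 2 * \<theta>) * n * n" using q by (rule mult_right_mono) simp
      moreover have "0 \<le> q * q" by simp
      moreover have "(1 - 2 * (\<kappa> + 2 * \<theta>)) * real n ^ 2 =
          real n ^ 2 - 2 * ((\<kappa> + 2 * \<theta>) * n * n)"
        by (simp add: power2_eq_square algebra_simps)
      ultimately show ?thesis by linarith
    qed
    show ?thesis using 1 2 good by (simp add: power2_eq_square algebra_simps)
  qed
  moreover have "L \<subseteq> hubs \<eta>" by (auto simp: L_def hub_nbrs_def)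
  ultimately show ?thesis using L_card unfolding GY_def by blast
qed

text \<open>With \<open>x\<close> and \<open>y\<close> low, the hub of \<open>{x, y, w}\<close> is
  recognisable as the vertex outside \<open>low M\<close>, so only the order of \<open>x\<close> and
  \<open>y\<close> is lost. Taking \<open>L'\<close> to be \<open>L\<close> or a singleton yields
  the number of edges meeting \<open>L\<close> or a degree.\<close>

lemma card_edges_meeting:
  assumes "hubs \<eta> \<inter> low M = {}" and "L \<subseteq> hubs \<eta>" and "L' \<subseteq> L"
  shows "card {(x, y)\<in>good \<eta> M. \<forall>w\<in>L. {x, y, w} \<in> H} * card L' \<le> 2 * card {e\<in>H. e \<inter> L' \<noteq> {}}"
proof -
  define GY where "GY = {(x, y)\<in>good \<eta> M. \<forall>w\<in>L. {x, y, w} \<in> H}"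
  define f where "f = (\<lambda>((x::nat, y), w). {x, y, w})"
  have GY_low: "x \<in> low M \<and> y \<in> low M" if "(x, y) \<in> GY" for x y
    using that good_sub by (auto simp: GY_def)
  have finGY: "finite GY"
    using GY_low fin_low by (intro finite_subset[of GY "low M \<times> low M"]) auto
  have L'_hubs: "L' \<subseteq> hubs \<eta>" using assms(2,3) by simp
  then have finL: "finite L'" using fin_hubs by (rule finite_subset)
  have "card (GY \<times> L') \<le> 2 * card {e\<in>H. e \<inter> L' \<noteq> {}}"
  proof (rule card_fibres_le[where f = f])
    show "f ` (GY \<times> L') \<subseteq> {e\<in>H. e \<inter> L' \<noteq> {}}"
      using assms(3) by (auto simp: f_def GY_def)
    fix e
    show "card {t\<in>GY \<times> L'. f t = e} \<le> 2"
    proof (cases "{t\<in>GY \<times> L'. f t = e} = {}")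
      case False
      then obtain x y w where xyw: "(x, y) \<in> GY" "w \<in> L'" "e = {x, y, w}" by (auto simp: f_def)
      have "{t\<in>GY \<times> L'. f t = e} \<subseteq> {((x, y), w), ((y, x), w)}"
      proof
        fix t assume t: "t \<in> {t\<in>GY \<times> L'. f t = e}"
        obtain x' y' w' where t': "t = ((x', y'), w')" by (metis prod.collapse)
        have m: "(x', y') \<in> GY" "w' \<in> L'" "{x', y', w'} = {x, y, w}"
          using t xyw(3) by (auto simp: t' f_def)
        have hub: "v \<notin> low M" if "v \<in> L'" for v using assms(1) L'_hubs that by auto
        have "x' \<noteq> y'" "x \<noteq> y" using m(1) xyw(1) by (auto simp: GY_def good_def light_pairs_def)
        moreover have "x \<noteq> w" "y \<noteq> w" "x \<noteq> w'" "y \<noteq> w'" "x' \<noteq> w" "y' \<noteq> w" "x' \<noteq> w'" "y' \<noteq> w'"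
          using GY_low[OF m(1)] GY_low[OF xyw(1)] hub[OF m(2)] hub[OF xyw(2)] by auto
        moreover have "w' \<in> {x, y, w}" "x' \<in> {x, y, w}" "y' \<in> {x, y, w}" using m(3) by blast+
        ultimately show "t \<in> {((x, y), w), ((y, x), w)}" by (auto simp: t')
      qed
      then have "card {t\<in>GY \<times> L'. f t = e} \<le> card {((x, y), w), ((y, x), w)}"
        by (intro card_mono) auto
      also have "\<dots> \<le> 2" using card_length[of "[((x, y), w), ((y, x), w)]"] by simp
      finally show ?thesis .
    next
      case True
      show ?thesis unfolding True by simp
    qed
  qed (use finGY finL finH in auto)
  then show ?thesis by (simp add: card_cartesian_product GY_def)
qed

text \<open>The edge count makes almost all pairs good, and \<open>dominant_hubs\<close> yields
  \<open>L\<close>. The edges meeting \<open>L\<close> then nearly exhaust the upper bound on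
  \<open>card H\<close>, so few edges avoid \<open>L\<close>.\<close>

lemma stability:
  fixes \<theta> \<delta> \<eta> :: real
  assumes s: "card A \<ge> 1" and n: "n > 0" and M: "real M < \<eta> * n" and \<eta>: "\<eta> > 0"
    and \<theta>: "0 < \<theta>" "\<theta> \<le> 1 / 20" "10 * card A * \<theta> \<le> \<delta>"
    and err: "4 * (4 * real (card V) ^ 2 * n + card ({..<n} - low M) * n * (2 * card V) +
        2 * card V * \<eta> * real n ^ 2 + 2 ^ card (hubs \<eta>)) +
      (8 * real (card V) + 1) * real (card (bad \<eta> M)) \<le> \<theta> * real n ^ 2"
    and exc: "card {x\<in>low M. card A \<le> card (hub_nbrs \<eta> x)} \<le> \<theta> * n"
    and H: "((real (card A) - 1) / 2 - \<theta>) * real n ^ 2 \<le> card H"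
  shows "delta_close \<delta> n H (card A - 1)"
proof -
  define N where "N = real n ^ 2"
  define D where "D = 4 * real (card V) ^ 2 * n + card ({..<n} - low M) * n * (2 * card V) +
        2 * card V * \<eta> * N + 2 ^ card (hubs \<eta>)"
  define B where "B = (8 * real (card V) + 1) * real (card (bad \<eta> M))"
  have N: "N > 0" using n by (simp add: N_def)
  have err': "4 * D + B \<le> \<theta> * N" using err by (simp add: D_def B_def N_def)
  have H_le: "2 * real (card H) \<le> card (pointed \<eta> M) + 2 * D"
    using edges_le_pointed[OF \<eta>] by (simp add: D_def N_def)
  have B0: "B \<ge> 0" by (simp add: B_def)
  show ?thesis
  proof (cases "card A = 1")
    case True
    \<comment> \<open>For \<open>card A = 1\<close> only bad pairs and error terms contribute edges,
      and the empty set serves as \<open>L\<close>.\<close>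
    have "real (card (pointed \<eta> M)) \<le> real (4 * card V * card (bad \<eta> M))"
      using pointed_le(2)[OF s True] by (rule of_nat_mono)
    also have "\<dots> \<le> B" by (simp add: B_def algebra_simps)
    finally have "4 * real (card H) \<le> 2 * (4 * D + B)" using H_le err' B0 \<theta>(1)
      by (smt (verit) D_def \<eta> N mult_nonneg_nonneg of_nat_0_le_iff zero_le_power)
    then have "real (card H) \<le> \<theta> * N" using err' N \<theta>(1) by (smt (verit) mult_pos_pos)
    also have "\<dots> \<le> \<delta> * N" using \<theta> N True by (intro mult_right_mono) auto
    finally show ?thesis
      using True unfolding delta_close_def by (intro exI[of _ "{}"]) (simp add: delete3_def N_def)
  next
    case False
    then have s2: "card A \<ge> 2" using s by simp
    have "2 * real (card (pointed \<eta> M)) \<le>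
      (2 * (real (card A) - 1) - 1) * card (light_pairs M) + card (good \<eta> M) + B"
      using pointed_le(1)[OF s, of \<eta> M] by (simp add: B_def)
    moreover have "(2 * (real (card A) - 1) - 1) * card (light_pairs M) \<le> (2 * (real (card A) - 1) - 1) * N"
      using s2 of_nat_mono[OF card_light_pairs, of M, where 'a = real]
      by (intro mult_left_mono) (auto simp: N_def)
    ultimately have main: "4 * real (card H) \<le>
        (2 * (real (card A) - 1) - 1) * N + card (good \<eta> M) + (4 * D + B)"
      using H_le by linarith
    have "card (good \<eta> M) \<le> n\<^sup>2"
    proof -
      have "good \<eta> M \<subseteq> light_pairs M" by (auto simp: good_def)
      then show ?thesis using card_light_pairs fin_light_pairs by (meson card_mono le_trans)
    qed
    from of_nat_mono[OF this, where 'a = real]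
    have good_N: "card (good \<eta> M) \<le> N" by (simp add: N_def)
    have H': "2 * (real (card A) - 1) * N - 4 * (\<theta> * N) \<le> 4 * real (card H)"
      using H by (simp add: N_def algebra_simps)
    \<comment> \<open>The deficit of \<open>H\<close> accounts for \<open>4 * \<theta>\<close>, the
      error terms for one more \<theta>.\<close>
    have good: "(1 - 5 * \<theta>) * real n ^ 2 \<le> card (good \<eta> M)"
      using main H' err' by (simp add: algebra_simps flip: N_def)
    \<comment> \<open>With \<kappa> equal to \<open>5 * \<theta>\<close> the total loss is
      \<open>15 * \<theta> + 4 * \<theta> = 19 * \<theta>\<close>.\<close>
    obtain L where L: "L \<subseteq> hubs \<eta>" "card L = card A - 1"
      "(1 - 3 * (5 * \<theta>) - 4 * \<theta>) * real n ^ 2 \<le> card {(x, y)\<in>good \<eta> M. \<forall>w\<in>L. {x, y, w} \<in> H}"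
      using dominant_hubs[OF n _ _ _ s good exc] \<theta> by auto
    define g where "g = real (card {(x, y)\<in>good \<eta> M. \<forall>w\<in>L. {x, y, w} \<in> H})"
    have g: "(1 - 19 * \<theta>) * N \<le> g" using L(3) by (simp add: g_def N_def)
    have meet: "g * card L' \<le> 2 * real (card {e\<in>H. e \<inter> L' \<noteq> {}})" if "L' \<subseteq> L" for L'
      using of_nat_mono[OF card_edges_meeting[OF hubs_low[OF M] L(1) that], where 'a = real]
      by (simp add: g_def)
    have \<delta>: "10 * \<theta> \<le> \<delta>"
    proof -
      have "10 * \<theta> * 1 \<le> 10 * \<theta> * card A" using \<theta>(1) s by (intro mult_left_mono) auto
      then show ?thesis using \<theta>(3) by (simp add: mult_ac)
    qed
    have "real (card (delete3 H L)) \<le> \<delta> * N"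
    proof -
      have "H = delete3 H L \<union> {e\<in>H. e \<inter> L \<noteq> {}}" "delete3 H L \<inter> {e\<in>H. e \<inter> L \<noteq> {}} = {}"
        by (auto simp: delete3_def)
      then have "card H = card (delete3 H L) + card {e\<in>H. e \<inter> L \<noteq> {}}"
        using finH by (metis card_Un_disjoint finite_Un)
      then have "2 * real (card (delete3 H L)) = 2 * real (card H) - 2 * real (card {e\<in>H. e \<inter> L \<noteq> {}})"
        by simp
      also have "\<dots> \<le> 2 * real (card H) - g * card L" using meet[of L] by simp
      also have "g * card L = g * (real (card A) - 1)" using L(2) s by (simp add: of_nat_diff)
      finally have 1: "2 * real (card (delete3 H L)) \<le> 2 * real (card H) - g * (real (card A) - 1)" .
      have "(1 - 19 * \<theta>) * N * (real (card A) - 1) \<le> g * (real (card A) - 1)"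
        using g s by (intro mult_right_mono) auto
      then have "4 * real (card (delete3 H L)) \<le>
          4 * real (card H) - 2 * ((1 - 19 * \<theta>) * N * (real (card A) - 1))" using 1 by linarith
      \<comment> \<open>Bounding the number of good pairs by \<open>N\<close> turns the same count
        into an upper bound on \<open>card H\<close>.\<close>
      also have "\<dots> \<le> 2 * (real (card A) - 1) * N + \<theta> * N - 2 * ((1 - 19 * \<theta>) * N * (real (card A) - 1))"
        using main good_N err' by (simp add: algebra_simps)
      also have "\<dots> = (38 * card A * \<theta> - 37 * \<theta>) * N" by (simp add: algebra_simps)
      also have "\<dots> \<le> (4 * \<delta>) * N"
      proof (rule mult_right_mono)
        have "0 \<le> card A * \<theta>" using \<theta>(1) by simp
        then show "38 * card A * \<theta> - 37 * \<theta> \<le> 4 * \<delta>" using \<theta>(1,3) by linarith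
      qed (use N in simp)
      finally show ?thesis by simp
    qed
    moreover have "(1 / 2 - \<delta>) * N \<le> degree3 H v" if "v \<in> L" for v
    proof -
      have "{e\<in>H. e \<inter> {v} \<noteq> {}} = {e\<in>H. v \<in> e}" by auto
      then have "g \<le> 2 * real (degree3 H v)" using meet[of "{v}"] that by (simp add: degree3_def)
      then have "(1 - 19 * \<theta>) / 2 * N \<le> degree3 H v" using g by linarith
      moreover have "(1 / 2 - \<delta>) * N \<le> (1 - 19 * \<theta>) / 2 * N"
        using \<delta> \<theta>(1) N by (intro mult_right_mono) auto
      ultimately show ?thesis by linarith
    qed
    ultimately show ?thesis
      unfolding delta_close_def N_def using L(1,2) hubs_sub by (intro exI[of _ L]) auto
  qed
qed

end

section \<open>Choice of constants and conclusion\<close>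

theorem theorem1p3:
  fixes V :: "'a set" and E :: "'a set set"
  assumes "is_tree V E"
    and "crosscut V E = tau_ind V E"
  shows "\<forall>\<delta>>0. \<exists>\<epsilon>>0. \<exists>n0::nat. \<forall>n\<ge>n0. \<forall>H.
           three_graph n H \<and> \<not> contains_expansion H V E \<and>
           real (card H) \<ge> ((real (crosscut V E) - 1) / 2 - \<epsilon>) * real n ^ 2
           \<longrightarrow> delta_close \<delta> n H (crosscut V E - 1)"
proof (intro allI impI)
  fix \<delta> :: real assume \<delta>: "\<delta> > 0"
  note gr = tree_grown[OF assms(1)]
  have finV: "finite V" and finE: "finite E" and cV: "card V = Suc (card E)"
    using grown_basic[OF gr] by auto
  define \<S> where "\<S> = {S. S \<subseteq> V \<and> (\<forall>e\<in>E. card (S \<inter> e) = 1)}"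
  have "finite \<S>" using finV by (simp add: \<S>_def)
  moreover have "\<S> \<noteq> {}" using grown_bipartite[OF gr] by (auto simp: \<S>_def)
  ultimately have "Min (card ` \<S>) \<in> card ` \<S>" by (intro Min_in) auto
  then obtain A where "A \<in> \<S>" and cA: "card A = tau_ind V E" by (auto simp: tau_ind_def \<S>_def)
  then have A: "A \<subseteq> V" "\<forall>e\<in>E. card (A \<inter> e) = 1" by (auto simp: \<S>_def)
  \<comment> \<open>The hypothesis enters here: \<sigma> becomes the size of a colour class.\<close>
  have s: "crosscut V E = card A" using assms(2) cA by simp
  define m where "m = real (card V)"
  have m: "m \<ge> 1" using cV by (simp add: m_def)
  \<comment> \<open>This also serves as \<epsilon>. The \<open>+ 1\<close> avoids a zero
    denominator, as \<open>card A\<close> is not yet known to be positive.\<close>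
  define \<theta> where "\<theta> = min (1 / 20) (\<delta> / (10 * (card A + 1)))"
  have \<theta>: "0 < \<theta>" "\<theta> \<le> 1 / 20"
  proof -
    show "0 < \<theta>" using \<delta> by (simp add: \<theta>_def)
    show "\<theta> \<le> 1 / 20" unfolding \<theta>_def by (rule min.cobounded1)
  qed
  have \<theta>\<delta>: "10 * card A * \<theta> \<le> \<delta>"
  proof -
    have "10 * card A * \<theta> \<le> 10 * (card A + 1) * \<theta>" using \<theta>(1) by (intro mult_right_mono) auto
    also have "\<dots> \<le> 10 * (card A + 1) * (\<delta> / (10 * (card A + 1)))"
      by (intro mult_left_mono) (auto simp: \<theta>_def)
    also have "\<dots> = \<delta>" by simp
    finally show ?thesis .
  qed
  \<comment> \<open>Makes the error from two fat pairs at a non-hub,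
    \<open>4 * (2 * m * \<eta> * n^2)\<close>, equal to \<open>\<theta> / 4 * n^2\<close>.\<close>
  define \<eta> where "\<eta> = \<theta> / (32 * m)"
  have \<eta>: "\<eta> > 0" using \<theta> m by (simp add: \<eta>_def)
  \<comment> \<open>At most \<open>2 * m * n / M\<close> vertices lie outside \<open>low M\<close>;
    their error \<open>16 * m^2 * n^2 / M\<close> thus stays below
    \<open>\<theta> / 4 * n^2\<close>.\<close>
  define M where "M = nat \<lceil>64 * m\<^sup>2 / \<theta>\<rceil>"
  have M: "64 * m\<^sup>2 \<le> \<theta> * M"
  proof -
    have "64 * m\<^sup>2 / \<theta> \<le> M" unfolding M_def by (rule real_nat_ceiling_ge)
    then show ?thesis using \<theta>(1) by (simp add: field_simps)
  qed
  \<comment> \<open>Here \<open>w\<close> bounds the number of hubs for every positive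
    \<open>n\<close>, and \<open>K * n\<close> is the bound from the embedding lemmas with
    \<open>Q = low M\<close>.\<close>
  define w where "w = nat \<lfloor>2 * m / \<eta>\<rfloor>"
  define K where "K = 2 * (card V * (M + 1)\<^sup>2)"
  \<comment> \<open>The remaining error terms, constant or linear in \<open>n\<close>, add up to at
    most \<open>c * n\<close>.\<close>
  define c where "c = 16 * m\<^sup>2 + 4 * (2::real) ^ w + (8 * m + 1) * ((1 + 2 * 2 ^ w) * real K)"
  have c: "c \<ge> 0" using m by (simp add: c_def)
  \<comment> \<open>The three thresholds give \<open>c * n \<le> \<theta> / 2 * n^2\<close>,
    disjointness of hubs and low vertices, and \<open>K * n \<le> r^2\<close> for
    \<open>r = \<theta> * n / 2 ^ w\<close> in \<open>card_exceptional\<close>. The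
    \<open>+ 1\<close> makes them strict and \<open>n\<close> positive.\<close>
  define n0 where "n0 = nat \<lceil>max (2 * c / \<theta>) (max (M / \<eta>) (real K * (2 ^ w / \<theta>)\<^sup>2))\<rceil> + 1"
  have main: "delta_close \<delta> n H (crosscut V E - 1)"
    if n: "n \<ge> n0" and H: "three_graph n H" "\<not> contains_expansion H V E"
      "real (card H) \<ge> ((real (crosscut V E) - 1) / 2 - \<theta>) * real n ^ 2" for n H
  proof -
    interpret expansion_free V E A n H
      using assms(1) A H by unfold_locales auto
    have "max (2 * c / \<theta>) (max (M / \<eta>) (real K * (2 ^ w / \<theta>)\<^sup>2)) < real n"
      using n real_nat_ceiling_ge[of "max (2 * c / \<theta>) (max (M / \<eta>) (real K * (2 ^ w / \<theta>)\<^sup>2))"]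
      by (simp add: n0_def)
    then have big: "2 * c / \<theta> < n" "M / \<eta> < n" "real K * (2 ^ w / \<theta>)\<^sup>2 < n" by auto
    have n_pos: "n > 0" using n by (simp add: n0_def)
    have cn: "2 * c \<le> \<theta> * n" using big(1) \<theta>(1) by (simp add: field_simps)
    have Mn: "real M < \<eta> * n" using big(2) \<eta> by (simp add: field_simps)
    have w: "card (hubs \<eta>) \<le> w"
      using card_hubs[OF \<eta> n_pos] by (simp add: w_def m_def le_nat_floor)
    have w2: "(2::real) ^ card (hubs \<eta>) \<le> 2 ^ w" using w by (intro power_increasing) auto
    \<comment> \<open>Otherwise the tree is a single vertex, and its edgeless expansion is contained
      in every \<open>H\<close>.\<close>
    have "card A \<ge> 1"
    proof (rule ccontr)
      assume "\<not> ?thesis"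
      then have "A = {}" using finite_subset[OF A(1) finV] by (simp add: not_le)
      then have "E = {}" using A(2) by auto
      then have "card V = 1" using cV by simp
      then obtain r where "V = {r}" by (auto simp: card_1_singleton_iff)
      then have "contains_expansion H V E"
        using \<open>E = {}\<close> by (auto simp: contains_expansion_def)
      then show False using H(2) by simp
    qed
    then show ?thesis unfolding s
    proof (rule stability[OF _ n_pos Mn \<eta> \<theta> \<theta>\<delta>])
      show "((real (card A) - 1) / 2 - \<theta>) * (real n)\<^sup>2 \<le> real (card H)" using H(3) s by simp
      have "real (card {x\<in>low M. card A \<le> card (hub_nbrs \<eta> x)}) \<le> 2 ^ card (hubs \<eta>) * (\<theta> * n / 2 ^ w)"
      proof (rule card_exceptional[OF Mn])
        show "0 \<le> \<theta> * n / 2 ^ w" using \<theta> by simp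
        have "real K * (2 ^ w)\<^sup>2 \<le> \<theta>\<^sup>2 * n" using big(3) \<theta>(1) by (simp add: field_simps)
        then have "real K * (2 ^ w)\<^sup>2 * n \<le> \<theta>\<^sup>2 * n * n" by (intro mult_right_mono) auto
        then show "real (2 * (card V * (M + 1)\<^sup>2) * n) \<le> (\<theta> * n / 2 ^ w)\<^sup>2"
          unfolding K_def[symmetric] by (simp add: field_simps power2_eq_square)
      qed
      also have "\<dots> \<le> 2 ^ w * (\<theta> * n / 2 ^ w)" using w2 \<theta> by (intro mult_right_mono) auto
      finally show "real (card {x\<in>low M. card A \<le> card (hub_nbrs \<eta> x)}) \<le> \<theta> * n" by simp
      define N where "N = real n ^ 2"
      define h where "h = real (card ({..<n} - low M))"
      have "M * h \<le> 2 * m * n"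
        using of_nat_mono[OF card_high[of M], where 'a = real] by (simp add: h_def m_def)
      then have "\<theta> * M * h \<le> \<theta> * (2 * m * n)" using \<theta>(1) by (simp add: mult.assoc)
      moreover have "64 * m\<^sup>2 * h \<le> \<theta> * M * h" using M by (intro mult_right_mono) (auto simp: h_def)
      ultimately have "64 * m\<^sup>2 * h \<le> \<theta> * (2 * m * n)" by linarith
      then have "m * (32 * m * h) \<le> m * (\<theta> * n)" by (simp add: power2_eq_square mult_ac)
      then have "32 * m * h \<le> \<theta> * n" using m by simp
      then have "32 * m * h * n \<le> \<theta> * n * n" by (rule mult_right_mono) simp
      then have high: "4 * (h * n * (2 * m)) \<le> \<theta> / 4 * N" by (simp add: N_def power2_eq_square mult_ac)
      \<comment> \<open>The error budget: half for the terms collected in \<open>c\<close>, a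
        quarter each for high vertices and for two fat pairs at a non-hub.\<close>
      have split_error: "4 * (a + b + d + e) + f \<le> t"
        if "4 * (a + e) + f \<le> t / 2" "4 * b \<le> t / 4" "4 * d = t / 4" for a b d e f t :: real
        using that unfolding distrib_left by linarith
      have cherry: "4 * (2 * m * \<eta> * N) = \<theta> / 4 * N" using m by (simp add: \<eta>_def)
      have "real (card (bad \<eta> M)) \<le> real ((1 + 2 * 2 ^ card (hubs \<eta>)) * (K * n))"
        using card_bad[OF Mn] unfolding K_def by (rule of_nat_mono)
      also have "\<dots> = (1 + 2 * 2 ^ card (hubs \<eta>)) * (real K * n)" by (simp add: algebra_simps)
      also have "\<dots> \<le> (1 + 2 * 2 ^ w) * (real K * n)" using w2 by (intro mult_right_mono) auto
      finally have b: "(8 * m + 1) * card (bad \<eta> M) \<le> (8 * m + 1) * ((1 + 2 * 2 ^ w) * (real K * n))"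
        using m by (intro mult_left_mono) auto
      have "4 * (4 * m\<^sup>2 * n + 2 ^ card (hubs \<eta>)) + (8 * m + 1) * card (bad \<eta> M) \<le>
          16 * m\<^sup>2 * n + 4 * (2::real) ^ w * n + (8 * m + 1) * ((1 + 2 * 2 ^ w) * (real K * n))"
      proof -
        have "(2::real) ^ w * 1 \<le> 2 ^ w * real n" using n_pos by (intro mult_left_mono) auto
        then have "4 * 2 ^ card (hubs \<eta>) \<le> 4 * 2 ^ w * real n" using w2 by linarith
        then have "16 * m\<^sup>2 * n + 4 * 2 ^ card (hubs \<eta>) \<le> 16 * m\<^sup>2 * n + 4 * 2 ^ w * real n"
          by (rule add_left_mono)
        moreover have "4 * (4 * m\<^sup>2 * n + 2 ^ card (hubs \<eta>)) = 16 * m\<^sup>2 * n + 4 * 2 ^ card (hubs \<eta>)"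
          by simp
        ultimately show ?thesis using b by (metis add_mono)
      qed
      also have "\<dots> = c * n" by (simp add: c_def algebra_simps)
      also have "\<dots> \<le> \<theta> / 2 * n * n" using cn by (intro mult_right_mono) auto
      also have "\<dots> = \<theta> / 2 * N" by (simp add: N_def power2_eq_square)
      finally have "4 * (4 * m\<^sup>2 * n + h * n * (2 * m) + 2 * m * \<eta> * N + 2 ^ card (hubs \<eta>)) +
          (8 * m + 1) * card (bad \<eta> M) \<le> \<theta> * N" using high cherry by (intro split_error) simp_all
      then show "4 * (4 * (real (card V))\<^sup>2 * n + card ({..<n} - low M) * n * (2 * card V) +
            2 * card V * \<eta> * (real n)\<^sup>2 + 2 ^ card (hubs \<eta>)) +
          (8 * real (card V) + 1) * real (card (bad \<eta> M)) \<le> \<theta> * (real n)\<^sup>2"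
        by (simp add: m_def h_def N_def)
    qed
  qed
  show "\<exists>\<epsilon>>0. \<exists>n0::nat. \<forall>n\<ge>n0. \<forall>H. three_graph n H \<and> \<not> contains_expansion H V E \<and>
      real (card H) \<ge> ((real (crosscut V E) - 1) / 2 - \<epsilon>) * real n ^ 2
      \<longrightarrow> delta_close \<delta> n H (crosscut V E - 1)"
    using main \<theta>(1) by (intro exI[of _ \<theta>] conjI exI[of _ n0]) simp_all
qed

end
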